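(* Let $f$ be a function on $[-1,1]$ whose Chebyshev coefficients $a_n$ satisfy either $$a_n\sim\sum_{k=0}^{\infty}\frac{\mu_k}{n^{d_k}},\qquad n\to\infty,$$ or $$a_n\sim(-1)^n\sum_{k=0}^{\infty}\frac{\mu_k}{n^{d_k}},\qquad n\to\infty,$$ where the $\mu_k$ are constants independent of $n$ and $0<d_0<d_1<\cdots$. Then there are constants $\varsigma_{j,k}$ independent of $n$ such that, for even $n$, the error of the Clenshaw-Curtis quadrature has the asymptotic expansion $$E_n^C[f]\sim\sum_{k=0}^{\infty}\sum_{j=0}^{\infty}\frac{\varsigma_{j,k}}{n^{d_k+2j+1}},\qquad n\to\infty.$$
   Context: The Chebyshev coefficients of $f$ are $a_n=\frac{2}{\pi}\int_0^{\pi}f(\cos t)\cos(nt)\,dt$; $f$ is taken to be continuous on $[-1,1]$ (the quadrature uses its values at both endpoints). The $(n+1)$-point Clenshaw-Curtis rule is $I_n^C[f]=\sum_{j=0}^n w_jf(x_j)$ with nodes $x_j=\cos(j\pi/n)$, $j=0,\dots,n$, and weights $$w_j=\frac{4\delta_j}{n}\sum_{k=0}^{\lfloor n/2\rfloor}\frac{\delta_{2k}}{1-4k^2}\cos\Big(\frac{2jk\pi}{n}\Big),$$ where $\delta_j=1/2$ if $j=0$ or $j=n$, and $\delta_j=1$ otherwise; equivalently, it is the interpolatory quadrature rule at these nodes (exact for polynomials of degree at most $n$). The error is $E_n^C[f]=\int_{-1}^1f(x)\,dx-I_n^C[f]$. Asymptotic expansions ($\sim$) are understood in the Poincaré sense: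 for every real $M$ only finitely many terms have exponent of $1/n$ at most $M$ (so $d_k\to\infty$), and the difference between the left-hand side and the sum of the terms with exponent of $1/n$ at most $M$ is $o(n^{-M})$ as $n\to\infty$ (through even $n$ in the conclusion). *)

theory Defs
  imports "HOL-Analysis.Analysis" "HOL-Library.Landau_Symbols"
begin

definition cheb_coeff :: "(real \<Rightarrow> real) \<Rightarrow> nat \<Rightarrow> real" where
  "cheb_coeff f n = 2 / pi * integral {0..pi} (\<lambda>t. f (cos t) * cos (real n * t))"

definition cc_delta :: "nat \<Rightarrow> nat \<Rightarrow> real" where
  "cc_delta n j = (if j = 0 \<or> j = n then 1 / 2 else 1)"

definition cc_node :: "nat \<Rightarrow> nat \<Rightarrow> real" where
  "cc_node n j = cos (real j * pi / real n)"

definition cc_weight :: "nat \<Rightarrow> nat \<Rightarrow> real" where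
  "cc_weight n j = 4 * cc_delta n j / real n *
     (\<Sum>k = 0..n div 2. cc_delta n (2 * k) / (1 - 4 * (real k)\<^sup>2) *
        cos (2 * real j * real k * pi / real n))"

definition cc_quad :: "nat \<Rightarrow> (real \<Rightarrow> real) \<Rightarrow> real" where
  "cc_quad n f = (\<Sum>j = 0..n. cc_weight n j * f (cc_node n j))"

definition cc_error :: "nat \<Rightarrow> (real \<Rightarrow> real) \<Rightarrow> real" where
  "cc_error n f = integral {-1..1} f - cc_quad n f"

(* A formal series of terms trm i n, where trm i has exponent expo i of 1/n.
   The exponent is a separate argument so that a factor (-1)^n or a zero coefficient
   may occur in a term.  The index type is arbitrary; for a double series it is nat \<times> nat. *)
definition poincare_expansion ::
  "nat filter \<Rightarrow> (nat \<Rightarrow> real) \<Rightarrow> ('i \<Rightarrow> real) \<Rightarrow> ('i \<Rightarrow> nat \<Rightarrow> real) \<Rightarrow> bool" where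
  "poincare_expansion F g expo trm \<longleftrightarrow>
     (\<forall>M :: real. finite {i. expo i \<le> M} \<and>
        (\<lambda>n. g n - (\<Sum>i | expo i \<le> M. trm i n)) \<in> o[F](\<lambda>n. real n powr (- M)))"

definition even_sequentially :: "nat filter" where
  "even_sequentially = inf sequentially (principal {n. even n})"

end

theory Submission
  imports Defs
begin

text \<open>Write f as the series of the a_m T_m, with a_0 halved. The error is linear, so it is the sum of
the a_m E_n[T_m], and everything rests on the errors of the Chebyshev polynomials. Let n be even.
For odd m both the integral and the quadrature vanish, so only even m enter; this is why a factor
(-1)^m in the coefficients makes no difference. On even m \<le> n the rule is exact. An even m > n is
m = 2n(l+1) + k with k even and |k| \<le> n. At the nodes T_m agrees with T_|k|, a polynomial of degree at most n, and on such
polynomials the rule is exact. Hence E_n[T_m] = 2/(1-m^2) - 2/(1-k^2), and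

  E_n[f] = \<Sum>_l \<Sum>_k a_m (2/(1-m^2) - 2/(1-k^2)),   m = 2n(l+1) + k,

where the end points k = -n and k = n are shared by neighbouring blocks l, so that the inner sum
can be taken as a trapezoidal sum over the even k (\<open>fold_term_sums_cc_error\<close>).

This needs an absolutely convergent Chebyshev series, although the exponents may be at most 1.
Continuity of f supplies it: by positivity of the Fejer kernel the Cesaro means of the series at
x = 1 and x = -1 are bounded, while a leading term \<mu>/n^d with d \<le> 1 would make one of them
diverge. So all terms with d_k \<le> 1 have \<mu>_k = 0 (\<open>slow_terms_vanish\<close>).

For coefficients m^(-d) with d > 1, the sum over l turns the factor m^(-d) into n^(-d) \<psi>(k/n), where
\<psi> is a Hurwitz zeta function, analytic in a disc of radius 2. Two kinds of sums remain.
Trapezoidal sums of \<psi>(k/n) over the n cells of [-1,1] have, by Euler-Maclaurin, the form n times a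
series in n^(-2) (\<open>trapezoid_pow_series_expansion\<close>). Weighted sums of \<psi>(k/n)/(1-k^2) reduce to these by
splitting off \<psi>(0) and using k^2/(1-k^2) = 1/(1-k^2) - 1 repeatedly; each round gains a factor
n^(-2). The first step produces \<Sum> 1/(1-k^2) = n/(n^2-1), which is why a coefficient of order n^(-d)
gives an error of order n^(-d-1). The part with 1/(1-m^2) has a similar recursion in d. Together
they give n^(-d-1) times a series in n^(-2) (\<open>fold_term_powr_expansion\<close>).

Finally, coefficients of size o(m^(-M)) contribute only o(n^(-M)), since the sums of 1/|1-k^2| are
bounded (\<open>fold_term_smallo\<close>). Applying the expansion to the finitely many terms with exponent at most
M and this bound to the remainder gives the theorem.\<close>

section \<open>Expansions in even powers of 1/n along even n\<close>

lemma eventually_even_sequentially: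
  "eventually P even_sequentially \<longleftrightarrow> eventually (\<lambda>n. even n \<longrightarrow> P n) sequentially"
  by (simp add: even_sequentially_def eventually_inf_principal)

lemma even_sequentially_ge: "eventually (\<lambda>n. even n \<and> n \<ge> N) even_sequentially"
  unfolding eventually_even_sequentially using eventually_ge_at_top[of N]
  by eventually_elim simp

lemma bigo_even_sequentiallyI:
  fixes g h :: "nat \<Rightarrow> real"
  assumes "\<And>n. even n \<Longrightarrow> n \<ge> N \<Longrightarrow> \<bar>g n\<bar> \<le> C * \<bar>h n\<bar>"
  shows "g \<in> O[even_sequentially](h)"
  by (intro bigoI[of _ C] eventually_mono[OF even_sequentially_ge[of N]]) (use assms in auto)

text \<open>The coefficients are existentially quantified, so that having an expansion is a property of g,
to be passed through linear combinations and recursions without tracking the coefficients.\<close>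

definition even_expansion :: "(nat \<Rightarrow> real) \<Rightarrow> bool" where
  "even_expansion g \<longleftrightarrow> (\<exists>e :: nat \<Rightarrow> real. \<forall>J.
     (\<lambda>n. g n - (\<Sum>s<J. e s / real n ^ (2 * s))) \<in> O[even_sequentially](\<lambda>n. 1 / real n ^ (2 * J)))"

lemma even_expansion_lincomb:
  assumes "even_expansion g" "even_expansion h"
  shows "even_expansion (\<lambda>n. a * g n + b * h n)"
proof -
  obtain e where e: "\<And>J. (\<lambda>n. g n - (\<Sum>s<J. e s / real n ^ (2 * s))) \<in> O[even_sequentially](\<lambda>n. 1 / real n ^ (2 * J))"
    using assms(1) unfolding even_expansion_def by blast
  obtain e' where e': "\<And>J. (\<lambda>n. h n - (\<Sum>s<J. e' s / real n ^ (2 * s))) \<in> O[even_sequentially](\<lambda>n. 1 / real n ^ (2 * J))"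
    using assms(2) unfolding even_expansion_def by blast
  show ?thesis unfolding even_expansion_def
  proof (intro exI[of _ "\<lambda>s. a * e s + b * e' s"] allI)
    fix J
    have "(\<lambda>n. a * (g n - (\<Sum>s<J. e s / real n ^ (2 * s))) + b * (h n - (\<Sum>s<J. e' s / real n ^ (2 * s))))
       \<in> O[even_sequentially](\<lambda>n. 1 / real n ^ (2 * J))"
      by (intro sum_in_bigo) (use e[of J] e'[of J] in simp_all)
    then show "(\<lambda>n. a * g n + b * h n - (\<Sum>s<J. (a * e s + b * e' s) / real n ^ (2 * s)))
       \<in> O[even_sequentially](\<lambda>n. 1 / real n ^ (2 * J))"
      by (simp add: algebra_simps sum.distrib sum_distrib_left add_divide_distrib)
  qed
qed

lemma even_expansion_cong:
  assumes "\<And>n. even n \<Longrightarrow> n \<ge> N \<Longrightarrow> g n = h n"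
  shows "even_expansion g \<longleftrightarrow> even_expansion h"
proof -
  have "eventually (\<lambda>n. g n - x n = h n - x n) even_sequentially" for x :: "nat \<Rightarrow> real"
    using even_sequentially_ge[of N] by eventually_elim (simp add: assms)
  then have "((\<lambda>n. g n - x n) \<in> O[even_sequentially](f)) = ((\<lambda>n. h n - x n) \<in> O[even_sequentially](f))"
    for x f :: "nat \<Rightarrow> real"
    by (intro landau_o.big.in_cong)
  then show ?thesis unfolding even_expansion_def by presburger
qed

lemma even_expansion_bounded:
  assumes "even_expansion g" shows "g \<in> O[even_sequentially](\<lambda>n. 1)"
  using assms unfolding even_expansion_def by (auto dest!: spec[of _ 0])

lemma even_expansion_geometric: "even_expansion (\<lambda>n. (real n)\<^sup>2 / ((real n)\<^sup>2 - 1))"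
  unfolding even_expansion_def
proof (intro exI[of _ "\<lambda>_. 1"] allI)
  fix J
  show "(\<lambda>n. (real n)\<^sup>2 / ((real n)\<^sup>2 - 1) - (\<Sum>s<J. 1 / real n ^ (2 * s)))
       \<in> O[even_sequentially](\<lambda>n. 1 / real n ^ (2 * J))"
  proof (rule bigo_even_sequentiallyI[where N = 2 and C = 2])
    fix n :: nat assume "even n" "n \<ge> 2"
    define x where "x = 1 / (real n)\<^sup>2"
    have n2: "(real n)\<^sup>2 \<ge> 4" using \<open>n \<ge> 2\<close> power_mono[of 2 "real n" 2] by simp
    have x: "x > 0" "x \<le> 1 / 4" using n2 \<open>n \<ge> 2\<close> by (simp_all add: x_def divide_le_eq)
    have "(\<Sum>s<J. 1 / real n ^ (2 * s)) = (\<Sum>s<J. x ^ s)"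
      by (simp add: x_def power_mult power_one_over)
    also have "\<dots> = (1 - x ^ J) / (1 - x)"
      using x by (simp add: sum_gp_strict)
    finally have s: "(\<Sum>s<J. 1 / real n ^ (2 * s)) = (1 - x ^ J) / (1 - x)" .
    have "(real n)\<^sup>2 / ((real n)\<^sup>2 - 1) = 1 / (1 - x)"
      using n2 \<open>n \<ge> 2\<close> by (simp add: x_def field_simps)
    then have "(real n)\<^sup>2 / ((real n)\<^sup>2 - 1) - (\<Sum>s<J. 1 / real n ^ (2 * s)) = x ^ J / (1 - x)"
      unfolding s by (simp add: diff_divide_distrib)
    also have "\<bar>\<dots>\<bar> \<le> 2 * x ^ J"
    proof -
      have "1 / (1 - x) \<le> 2" using x by (simp add: field_simps)
      from mult_left_mono[OF this, of "x ^ J"] show ?thesis using x by simp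
    qed
    finally show "\<bar>(real n)\<^sup>2 / ((real n)\<^sup>2 - 1) - (\<Sum>s<J. 1 / real n ^ (2 * s))\<bar> \<le> 2 * \<bar>1 / real n ^ (2 * J)\<bar>"
      by (simp add: x_def power_mult power_one_over)
  qed
qed

text \<open>Unfolding a recursion G_i = A_i + G_(i+1)/n^2 puts the s-th coefficient of A_(i+r) in front of
n^(-2(s+r)); these are the resulting coefficients of G_i.\<close>

primrec chain_coeff :: "nat \<Rightarrow> (nat \<Rightarrow> nat \<Rightarrow> real) \<Rightarrow> nat \<Rightarrow> real" where
  "chain_coeff 0 \<alpha> i = \<alpha> i 0"
| "chain_coeff (Suc s) \<alpha> i = \<alpha> i (Suc s) + chain_coeff s \<alpha> (Suc i)"

text \<open>The device behind both recursions below. A crude bound on the G_i is enough to start: inserting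
it once into the recursion improves it to O(1), and each further insertion determines one more
coefficient.\<close>

lemma even_expansion_chain:
  assumes step: "\<And>i n. even n \<Longrightarrow> n \<ge> N \<Longrightarrow> G i n = A i n + G (Suc i) n / (real n)\<^sup>2"
    and A: "\<And>i. even_expansion (A i)"
    and bnd: "\<And>i. G i \<in> O[even_sequentially](\<lambda>n. (real n)\<^sup>2)"
  shows "even_expansion (G i)"
proof -
  have "\<forall>i. \<exists>e. \<forall>J. (\<lambda>n. A i n - (\<Sum>s<J. e s / real n ^ (2 * s))) \<in> O[even_sequentially](\<lambda>n. 1 / real n ^ (2 * J))"
    using A unfolding even_expansion_def by blast
  from choice[OF this] obtain \<alpha> where \<alpha>:
    "\<And>i J. (\<lambda>n. A i n - (\<Sum>s<J. \<alpha> i s / real n ^ (2 * s))) \<in> O[even_sequentially](\<lambda>n. 1 / real n ^ (2 * J))"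
    by blast
  have pos: "eventually (\<lambda>n. even n \<and> n \<ge> max N 1) even_sequentially"
    by (rule even_sequentially_ge)
  have "(\<lambda>n. G i n - (\<Sum>s<J. chain_coeff s \<alpha> i / real n ^ (2 * s))) \<in> O[even_sequentially](\<lambda>n. 1 / real n ^ (2 * J))" for J
  proof (induction J arbitrary: i)
    case 0
    have "(\<lambda>n. G (Suc i) n / (real n)\<^sup>2) \<in> O[even_sequentially](\<lambda>n. (real n)\<^sup>2 / (real n)\<^sup>2)"
      by (intro landau_o.big.divide_right bnd) (use pos in eventually_elim, auto)
    also have "(\<lambda>n. (real n)\<^sup>2 / (real n)\<^sup>2) \<in> O[even_sequentially](\<lambda>n. 1)"
      by (rule bigo_even_sequentiallyI[where N = 1 and C = 1]) auto
    finally have "(\<lambda>n. A i n + G (Suc i) n / (real n)\<^sup>2) \<in> O[even_sequentially](\<lambda>n. 1)"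
      by (intro sum_in_bigo(1) even_expansion_bounded[OF A])
    also have "?this \<longleftrightarrow> G i \<in> O[even_sequentially](\<lambda>n. 1)"
      by (intro landau_o.big.in_cong eventually_mono[OF even_sequentially_ge[of N]]) (simp add: step[of _ i])
    finally show ?case by simp
  next
    case (Suc J)
    have "(\<lambda>n. (G (Suc i) n - (\<Sum>s<J. chain_coeff s \<alpha> (Suc i) / real n ^ (2 * s))) / (real n)\<^sup>2)
       \<in> O[even_sequentially](\<lambda>n. 1 / real n ^ (2 * J) / (real n)\<^sup>2)"
      by (intro landau_o.big.divide_right Suc) (use pos in eventually_elim, auto)
    then have "(\<lambda>n. (A i n - (\<Sum>s<Suc J. \<alpha> i s / real n ^ (2 * s))) +
        (G (Suc i) n - (\<Sum>s<J. chain_coeff s \<alpha> (Suc i) / real n ^ (2 * s))) / (real n)\<^sup>2)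
       \<in> O[even_sequentially](\<lambda>n. 1 / real n ^ (2 * Suc J))"
      by (intro sum_in_bigo \<alpha>) (simp add: power_add mult_ac power2_eq_square)
    also have "?this \<longleftrightarrow> (\<lambda>n. G i n - (\<Sum>s<Suc J. chain_coeff s \<alpha> i / real n ^ (2 * s))) \<in> O[even_sequentially](\<lambda>n. 1 / real n ^ (2 * Suc J))"
    proof (intro landau_o.big.in_cong eventually_mono[OF pos], elim conjE)
      fix n :: nat assume n: "even n" "n \<ge> max N 1"
      have "(\<Sum>s<Suc J. chain_coeff s \<alpha> i / real n ^ (2 * s)) = chain_coeff 0 \<alpha> i + (\<Sum>s<J. chain_coeff (Suc s) \<alpha> i / real n ^ (2 * Suc s))"
        by (subst sum.lessThan_Suc_shift) simp
      also have "(\<Sum>s<J. chain_coeff (Suc s) \<alpha> i / real n ^ (2 * Suc s)) =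
         (\<Sum>s<J. \<alpha> i (Suc s) / real n ^ (2 * Suc s)) + (\<Sum>s<J. chain_coeff s \<alpha> (Suc i) / real n ^ (2 * s)) / (real n)\<^sup>2"
        by (simp add: add_divide_distrib sum.distrib sum_divide_distrib power_add mult_ac power2_eq_square)
      also have "chain_coeff 0 \<alpha> i + (\<dots>) = (\<Sum>s<Suc J. \<alpha> i s / real n ^ (2 * s)) + (\<Sum>s<J. chain_coeff s \<alpha> (Suc i) / real n ^ (2 * s)) / (real n)\<^sup>2"
        by (subst sum.lessThan_Suc_shift) simp
      finally show "(A i n - (\<Sum>s<Suc J. \<alpha> i s / real n ^ (2 * s))) +
        (G (Suc i) n - (\<Sum>s<J. chain_coeff s \<alpha> (Suc i) / real n ^ (2 * s))) / (real n)\<^sup>2 =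
        G i n - (\<Sum>s<Suc J. chain_coeff s \<alpha> i / real n ^ (2 * s))"
        using step[of n i] n by (simp add: diff_divide_distrib)
    qed
    finally show ?case .
  qed
  then have "\<forall>J. (\<lambda>n. G i n - (\<Sum>s<J. chain_coeff s \<alpha> i / real n ^ (2 * s))) \<in> O[even_sequentially](\<lambda>n. 1 / real n ^ (2 * J))"
    by blast
  then show ?thesis unfolding even_expansion_def by (intro exI[where x = "\<lambda>s. chain_coeff s \<alpha> i"])
qed

section \<open>Trapezoidal sums over the even integers between -n and n\<close>

text \<open>The sum of g over k = -n, -n+2, ..., n with the two end terms halved, written cell by cell so
that sums telescope and neighbouring blocks can be glued.\<close>

definition trapezoid :: "nat \<Rightarrow> (real \<Rightarrow> real) \<Rightarrow> real" where
  "trapezoid n g = (\<Sum>i<n. (g (2 * real i - real n) + g (2 * real i + 2 - real n)) / 2)"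

lemma trapezoid_lincomb: "trapezoid n (\<lambda>k. a * g k + b * h k) = a * trapezoid n g + b * trapezoid n h"
  by (simp add: trapezoid_def sum.distrib sum_distrib_left algebra_simps add_divide_distrib)

lemma trapezoid_cmult: "trapezoid n (\<lambda>k. a * g k) = a * trapezoid n g"
  using trapezoid_lincomb[of n a g 0 g] by simp

lemma trapezoid_mono:
  assumes "\<And>i. i \<le> n \<Longrightarrow> g (2 * real i - real n) \<le> h (2 * real i - real n)"
  shows "trapezoid n g \<le> trapezoid n h"
  unfolding trapezoid_def
proof (intro sum_mono divide_right_mono add_mono)
  fix i assume "i \<in> {..<n}"
  then show "g (2 * real i - real n) \<le> h (2 * real i - real n)"
    "g (2 * real i + 2 - real n) \<le> h (2 * real i + 2 - real n)"
    using assms[of i] assms[of "Suc i"] by (simp_all add: algebra_simps)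
qed simp

lemma trapezoid_cong:
  assumes "\<And>i. i \<le> n \<Longrightarrow> g (2 * real i - real n) = h (2 * real i - real n)"
  shows "trapezoid n g = trapezoid n h"
  by (intro antisym trapezoid_mono) (simp_all add: assms)

lemma abs_trapezoid_le:
  assumes "\<And>i. i \<le> n \<Longrightarrow> \<bar>g (2 * real i - real n)\<bar> \<le> h (2 * real i - real n)"
  shows "\<bar>trapezoid n g\<bar> \<le> trapezoid n h"
proof -
  have "trapezoid n g \<le> trapezoid n h"
  proof (rule trapezoid_mono)
    fix i assume "i \<le> n"
    from assms[OF this] show "g (2 * real i - real n) \<le> h (2 * real i - real n)" by linarith
  qed
  moreover have "trapezoid n (\<lambda>k. -1 * g k) \<le> trapezoid n h"
  proof (rule trapezoid_mono)
    fix i assume "i \<le> n"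
    from assms[OF this] show "-1 * g (2 * real i - real n) \<le> h (2 * real i - real n)" by linarith
  qed
  ultimately show ?thesis unfolding trapezoid_cmult by simp
qed

lemma trapezoid_reflect: "trapezoid n (\<lambda>k. g (- k)) = trapezoid n g"
proof -
  have "trapezoid n g = (\<Sum>i<n. (g (2 * real (n - Suc i) - real n) + g (2 * real (n - Suc i) + 2 - real n)) / 2)"
    unfolding trapezoid_def by (rule sum.nat_diff_reindex[symmetric])
  also have "\<dots> = trapezoid n (\<lambda>k. g (- k))"
    unfolding trapezoid_def by (intro sum.cong refl) (simp add: of_nat_diff algebra_simps)
  finally show ?thesis by simp
qed

lemma trapezoid_const: "trapezoid n (\<lambda>_. c) = real n * c"
  by (simp add: trapezoid_def)

lemma even_grid_nonsingular:
  assumes "even n" shows "(2 * real i - real n)\<^sup>2 \<noteq> 1"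
proof
  assume "(2 * real i - real n)\<^sup>2 = 1"
  then have "real_of_int ((2 * int i - int n)\<^sup>2) = real_of_int 1" by simp
  then have sq: "(2 * int i - int n)\<^sup>2 = 1" by (simp only: of_int_eq_iff)
  have "even ((2 * int i - int n)\<^sup>2)" using assms by simp
  then show False unfolding sq by simp
qed

text \<open>By partial fractions each cell is a difference of the values of k/(2(k^2-1)) at its two ends.\<close>

lemma trapezoid_recip:
  assumes "even n" "n \<ge> 2"
  shows "trapezoid n (\<lambda>k. 1 / (1 - k\<^sup>2)) = real n / ((real n)\<^sup>2 - 1)"
proof -
  define v where "v = (\<lambda>i. let k = 2 * real i - real n in k / (k\<^sup>2 - 1) / 2)"
  have "(1 / (1 - (2 * real i - real n)\<^sup>2) + 1 / (1 - (2 * real i + 2 - real n)\<^sup>2)) / 2 = v (Suc i) - v i" for i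
  proof -
    define k where "k = 2 * real i - real n"
    have ne: "k\<^sup>2 - 1 \<noteq> 0" "(k + 2)\<^sup>2 - 1 \<noteq> 0"
      using even_grid_nonsingular[OF assms(1), of i] even_grid_nonsingular[OF assms(1), of "Suc i"]
      by (simp_all add: k_def algebra_simps)
    have f: "k\<^sup>2 - 1 = (k - 1) * (k + 1)" "(k + 2)\<^sup>2 - 1 = (k + 1) * (k + 3)"
      by (simp_all add: algebra_simps power2_eq_square)
    have nz: "k - 1 \<noteq> 0" "k + 1 \<noteq> 0" "k + 3 \<noteq> 0" using ne unfolding f by auto
    have f': "1 - k\<^sup>2 = - ((k - 1) * (k + 1))" "1 - (k + 2)\<^sup>2 = - ((k + 1) * (k + 3))"
      by (simp_all add: algebra_simps power2_eq_square)
    have "v (Suc i) - v i = (k + 2) / ((k + 2)\<^sup>2 - 1) / 2 - k / (k\<^sup>2 - 1) / 2"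
      by (simp add: v_def k_def Let_def algebra_simps)
    also have "\<dots> = (1 / (1 - k\<^sup>2) + 1 / (1 - (k + 2)\<^sup>2)) / 2"
      unfolding f f' using nz by (simp add: divide_simps) (simp add: algebra_simps)
    finally have "v (Suc i) - v i = (1 / (1 - k\<^sup>2) + 1 / (1 - (k + 2)\<^sup>2)) / 2" .
    moreover have "2 * real i + 2 - real n = k + 2" by (simp add: k_def)
    ultimately show ?thesis by (simp only: k_def[symmetric])
  qed
  then have "trapezoid n (\<lambda>k. 1 / (1 - k\<^sup>2)) = v n - v 0"
    by (simp only: trapezoid_def sum_lessThan_telescope)
  moreover have "v n = real n / ((real n)\<^sup>2 - 1) / 2"
    by (simp add: v_def Let_def)
  moreover have "v 0 = - v n"
    by (simp add: v_def Let_def)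
  moreover have "a = b - c \<Longrightarrow> b = y / 2 \<Longrightarrow> c = - b \<Longrightarrow> a = y" for a b c y :: real by simp
  ultimately show ?thesis by blast
qed

text \<open>On the grid 1-k^2 is negative except at k = 0, so the sum of the absolute values differs from the
negated sum of 1/(1-k^2) only by the term at the origin.\<close>

lemma trapezoid_abs_recip_le:
  assumes "even n" "n \<ge> 2"
  shows "trapezoid n (\<lambda>k. 1 / \<bar>1 - k\<^sup>2\<bar>) \<le> 2"
proof -
  define \<delta> :: "real \<Rightarrow> real" where "\<delta> = (\<lambda>k. if k = 0 then 1 else 0)"
  obtain N where N: "n = 2 * N" using assms(1) by blast
  have "1 / \<bar>1 - k\<^sup>2\<bar> = 2 * \<delta> k + -1 * (1 / (1 - k\<^sup>2))" if "k = 2 * real i - real n" for k i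
  proof (cases "k = 0")
    case False
    define z where "z = 2 * int i - int n"
    have k: "k = of_int z" using that by (simp add: z_def)
    have "z \<noteq> 0" using False k by simp
    then have "z\<^sup>2 > 0" by simp
    then have "real_of_int (z\<^sup>2) \<ge> 1" by linarith
    then have "k\<^sup>2 \<ge> 1" by (simp add: k)
    then have "\<bar>1 - k\<^sup>2\<bar> = - (1 - k\<^sup>2)" by simp
    then show ?thesis using False by (simp only: \<delta>_def divide_minus_right) simp
  qed (simp add: \<delta>_def)
  then have "trapezoid n (\<lambda>k. 1 / \<bar>1 - k\<^sup>2\<bar>) = trapezoid n (\<lambda>k. 2 * \<delta> k + -1 * (1 / (1 - k\<^sup>2)))"
    by (intro trapezoid_cong) blast
  also have "\<dots> = 2 * trapezoid n \<delta> + -1 * (real n / ((real n)\<^sup>2 - 1))"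
    by (simp only: trapezoid_lincomb trapezoid_recip[OF assms])
  finally have eq: "trapezoid n (\<lambda>k. 1 / \<bar>1 - k\<^sup>2\<bar>) = 2 * trapezoid n \<delta> + -1 * (real n / ((real n)\<^sup>2 - 1))" .
  have "trapezoid n \<delta> \<le> 1"
  proof -
    have "trapezoid n \<delta> = (\<Sum>i<n. (if i = N then 1 / 2 else 0) + (if i = N - 1 then 1 / 2 else 0))"
      unfolding trapezoid_def
    proof (intro sum.cong refl)
      fix i
      have "2 * real i - real n = 0 \<longleftrightarrow> i = N" "2 * real i + 2 - real n = 0 \<longleftrightarrow> i = N - 1"
        using N assms(2) by (auto simp: of_nat_diff)
      then show "(\<delta> (2 * real i - real n) + \<delta> (2 * real i + 2 - real n)) / 2 =
        (if i = N then 1 / 2 else 0) + (if i = N - 1 then 1 / 2 else 0)"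
        by (simp add: \<delta>_def)
    qed
    also have "\<dots> \<le> 1" by (simp add: sum.distrib)
    finally show ?thesis .
  qed
  moreover have "real n / ((real n)\<^sup>2 - 1) \<ge> 0"
    using assms(2) power_mono[of 1 "real n" 2] by simp
  ultimately show ?thesis unfolding eq by linarith
qed

section \<open>The Euler-Maclaurin expansion of a trapezoidal sum\<close>

lemma taylor_bound:
  fixes F :: "nat \<Rightarrow> real \<Rightarrow> real"
  assumes deriv: "\<And>j x. \<bar>x\<bar> \<le> 1 \<Longrightarrow> (F j has_real_derivative F (Suc j) x) (at x)"
    and B: "\<And>x. \<bar>x\<bar> \<le> 1 \<Longrightarrow> \<bar>F (j + N) x\<bar> \<le> B"
    and c: "\<bar>c\<bar> \<le> 1" "\<bar>c + y\<bar> \<le> 1" and N: "N > 0"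
  shows "\<bar>F j (c + y) - (\<Sum>m<N. F (j + m) c / fact m * y ^ m)\<bar> \<le> B * \<bar>y\<bar> ^ N"
proof (cases "y = 0")
  case True
  have "(\<Sum>m<N. F (j + m) c / fact m * 0 ^ m) = (\<Sum>m\<in>{0}. F (j + m) c / fact m * 0 ^ m)"
    by (rule sum.mono_neutral_right) (use N in auto)
  then show ?thesis using True N by (simp add: power_0_left)
next
  case False
  have "\<exists>t. (if c + y < c then c + y < t \<and> t < c else c < t \<and> t < c + y) \<and>
    F j (c + y) = (\<Sum>m<N. (F (j + m) c / fact m) * (c + y - c) ^ m) + (F (j + N) t / fact N) * (c + y - c) ^ N"
    by (rule Taylor[where a = "-1" and b = 1 and diff = "\<lambda>m. F (j + m)"])
       (use N c False deriv in \<open>auto simp: abs_le_iff\<close>)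
  then obtain t where t0: "if c + y < c then c + y < t \<and> t < c else c < t \<and> t < c + y"
    and t2: "F j (c + y) = (\<Sum>m<N. (F (j + m) c / fact m) * y ^ m) + (F (j + N) t / fact N) * y ^ N"
    unfolding add_diff_cancel_left' by (elim exE conjE)
  have t1: "\<bar>t\<bar> \<le> 1" using t0 c by (auto simp: abs_le_iff split: if_splits)
  have "\<bar>F (j + N) t / fact N\<bar> \<le> B"
  proof -
    have "\<bar>F (j + N) t\<bar> / fact N \<le> \<bar>F (j + N) t\<bar> / 1"
      by (intro divide_left_mono) (auto simp: fact_ge_1)
    then show ?thesis using B[OF t1] by simp
  qed
  then have "\<bar>(F (j + N) t / fact N) * y ^ N\<bar> \<le> B * \<bar>y\<bar> ^ N"
    unfolding abs_mult power_abs[symmetric] by (intro mult_right_mono) auto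
  then show ?thesis using t2 by simp
qed

text \<open>With z coth z = \<Sum> \<beta>_q z^(2q), comparing coefficients in (\<Sum> \<beta>_q z^(2q)) (sinh z / z) = cosh z gives
this triangular system.\<close>

lemma coth_coefficients:
  obtains \<beta> :: "nat \<Rightarrow> real" where "\<And>q. (\<Sum>i\<le>q. \<beta> i / fact (2 * (q - i) + 1)) = 1 / fact (2 * q)"
proof -
  \<comment> \<open>C and D are cosh z and sinh z / z as series in z^2.\<close>
  define C D :: "real fps" where "C = Abs_fps (\<lambda>q. 1 / fact (2 * q))"
    and "D = Abs_fps (\<lambda>q. 1 / fact (2 * q + 1))"
  have "(C * inverse D) * D = C * (inverse D * D)" by (simp add: mult.assoc)
  also have "inverse D * D = 1" by (rule inverse_mult_eq_1) (simp add: D_def)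
  finally have eq: "(C * inverse D) * D = C" by simp
  have "(\<Sum>i\<le>q. fps_nth (C * inverse D) i / fact (2 * (q - i) + 1)) = 1 / fact (2 * q)" for q
    using arg_cong[OF eq, of "\<lambda>A. fps_nth A q"] unfolding fps_mult_nth[of _ D]
    by (simp add: C_def D_def atLeast0AtMost)
  then show ?thesis using that by blast
qed

lemma sum_odd_part:
  "(\<Sum>m<2 * K + 1. g m * y ^ m) - (\<Sum>m<2 * K + 1. g m * (- y) ^ m) = 2 * (\<Sum>p<K. g (2 * p + 1) * (y::real) ^ (2 * p + 1))"
  by (induction K) (simp_all add: algebra_simps)

lemma sum_even_part:
  "(\<Sum>m<2 * K. g m * y ^ m) + (\<Sum>m<2 * K. g m * (- y) ^ m) = 2 * (\<Sum>p<K. g (2 * p) * (y::real) ^ (2 * p))"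
  by (induction K) (simp_all add: algebra_simps)

lemma sum_triangle:
  "(\<Sum>s<J. \<Sum>p<J - s. h s p) = (\<Sum>q<J. \<Sum>i\<le>q. h i (q - i) :: real)" for J :: nat
proof -
  have "(\<Sum>s<J. \<Sum>p<J - s. h s p) = (\<Sum>(s, p)\<in>Sigma {..<J} (\<lambda>s. {..<J - s}). h s p)"
    by (rule sum.Sigma) auto
  also have "Sigma {..<J} (\<lambda>s. {..<J - s}) = {(s, p). s + p < J}" by auto
  finally show ?thesis by (simp add: sum.triangle_reindex)
qed

text \<open>Formally the trapezoid rule on a cell of half width \<eta> is \<eta> D coth(\<eta> D) applied to the difference
of F across the cell, where D is differentiation. Both sides are expanded by Taylor's
formula about the midpoint c: differences keep the odd powers of \<eta>, sums the even ones, and the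
coefficients of z coth z make the two expansions agree. Here F j is the j-th derivative of F 0,
and F 1 is the integrand.\<close>

lemma trapezoid_cell:
  fixes F :: "nat \<Rightarrow> real \<Rightarrow> real"
  assumes deriv: "\<And>j x. \<bar>x\<bar> \<le> 1 \<Longrightarrow> (F j has_real_derivative F (Suc j) x) (at x)"
    and B: "\<And>x. \<bar>x\<bar> \<le> 1 \<Longrightarrow> \<bar>F (2 * J + 1) x\<bar> \<le> B"
    and c: "\<bar>c - \<eta>\<bar> \<le> 1" "\<bar>c + \<eta>\<bar> \<le> 1" and \<eta>: "\<eta> > 0" and J: "J > 0"
    and \<beta>: "\<And>q. (\<Sum>i\<le>q. \<beta> i / fact (2 * (q - i) + 1)) = 1 / fact (2 * q)"
  shows "\<bar>\<eta> * (F 1 (c - \<eta>) + F 1 (c + \<eta>)) - (\<Sum>s<J. \<beta> s * \<eta> ^ (2 * s) * (F (2 * s) (c + \<eta>) - F (2 * s) (c - \<eta>)))\<bar>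
    \<le> (2 + 2 * (\<Sum>s<J. \<bar>\<beta> s\<bar>)) * B * \<eta> ^ (2 * J + 1)"
proof -
  have c0: "\<bar>c\<bar> \<le> 1" using c by linarith
  define a where "a = (\<lambda>j m. F (j + m) c / fact m)"
  define b where "b = F 1 (c + \<eta>) + F 1 (c - \<eta>)"
  have "\<bar>F 1 (c + \<eta>) - (\<Sum>m<2 * J. a 1 m * \<eta> ^ m)\<bar> \<le> B * \<bar>\<eta>\<bar> ^ (2 * J)"
    unfolding a_def by (intro taylor_bound deriv) (use c c0 J B in \<open>simp_all\<close>)
  moreover have "\<bar>F 1 (c + - \<eta>) - (\<Sum>m<2 * J. a 1 m * (- \<eta>) ^ m)\<bar> \<le> B * \<bar>- \<eta>\<bar> ^ (2 * J)"
    unfolding a_def by (intro taylor_bound deriv) (use c c0 J B in \<open>simp_all\<close>)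
  ultimately have "\<bar>b - 2 * (\<Sum>q<J. a 1 (2 * q) * \<eta> ^ (2 * q))\<bar> \<le> 2 * B * \<eta> ^ (2 * J)"
    unfolding b_def sum_even_part[symmetric] using \<eta> by (simp only: abs_minus abs_of_pos add_uminus_conv_diff)
  then have "\<bar>\<eta>\<bar> * \<bar>b - 2 * (\<Sum>q<J. a 1 (2 * q) * \<eta> ^ (2 * q))\<bar> \<le> \<bar>\<eta>\<bar> * (2 * B * \<eta> ^ (2 * J))"
    by (intro mult_left_mono) auto
  then have 1: "\<bar>\<eta> * b - 2 * (\<Sum>q<J. a 1 (2 * q) * \<eta> ^ (2 * q + 1))\<bar> \<le> 2 * B * \<eta> ^ (2 * J + 1)"
    unfolding abs_mult[symmetric] using \<eta> by (simp add: algebra_simps sum_distrib_left)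
  define D where "D = (\<lambda>s. F (2 * s) (c + \<eta>) - F (2 * s) (c - \<eta>))"
  define E where "E = (\<lambda>s. 2 * (\<Sum>p<J - s. a (2 * s) (2 * p + 1) * \<eta> ^ (2 * p + 1)))"
  have 2: "\<bar>\<beta> s * \<eta> ^ (2 * s) * D s - \<beta> s * \<eta> ^ (2 * s) * E s\<bar> \<le> 2 * \<bar>\<beta> s\<bar> * B * \<eta> ^ (2 * J + 1)" if s: "s < J" for s
  proof -
    have idx: "2 * s + (2 * (J - s) + 1) = 2 * J + 1" using s by simp
    have "\<bar>F (2 * s) (c + \<eta>) - (\<Sum>m<2 * (J - s) + 1. a (2 * s) m * \<eta> ^ m)\<bar> \<le> B * \<bar>\<eta>\<bar> ^ (2 * (J - s) + 1)"
      unfolding a_def by (intro taylor_bound deriv; (unfold idx)?) (use c c0 B in \<open>simp_all\<close>)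
    moreover have "\<bar>F (2 * s) (c + - \<eta>) - (\<Sum>m<2 * (J - s) + 1. a (2 * s) m * (- \<eta>) ^ m)\<bar> \<le> B * \<bar>- \<eta>\<bar> ^ (2 * (J - s) + 1)"
      unfolding a_def by (intro taylor_bound deriv; (unfold idx)?) (use c c0 B in \<open>simp_all\<close>)
    ultimately have *: "\<bar>D s - E s\<bar> \<le> 2 * B * \<eta> ^ (2 * (J - s) + 1)"
      unfolding D_def E_def sum_odd_part[symmetric] using \<eta> by (simp only: abs_minus abs_of_pos add_uminus_conv_diff) linarith
    have "\<bar>\<beta> s * \<eta> ^ (2 * s)\<bar> * \<bar>D s - E s\<bar> \<le> \<bar>\<beta> s * \<eta> ^ (2 * s)\<bar> * (2 * B * \<eta> ^ (2 * (J - s) + 1))"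
      by (intro mult_left_mono *) auto
    also have "\<dots> = 2 * \<bar>\<beta> s\<bar> * B * \<eta> ^ (2 * s + (2 * (J - s) + 1))"
      using \<eta> by (simp only: abs_mult power_add power_abs[symmetric]) (simp add: mult_ac)
    finally show ?thesis unfolding abs_mult[symmetric] idx by (simp only: right_diff_distrib)
  qed
  have "(\<Sum>s<J. \<beta> s * \<eta> ^ (2 * s) * E s) = (\<Sum>s<J. \<Sum>p<J - s. 2 * \<beta> s * a (2 * s) (2 * p + 1) * \<eta> ^ (2 * s + 2 * p + 1))"
    by (simp add: E_def sum_distrib_left power_add mult_ac)
  also have "\<dots> = (\<Sum>q<J. \<Sum>i\<le>q. 2 * \<beta> i * a (2 * i) (2 * (q - i) + 1) * \<eta> ^ (2 * i + 2 * (q - i) + 1))"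
    by (rule sum_triangle)
  also have "\<dots> = (\<Sum>q<J. \<Sum>i\<le>q. 2 * F (2 * q + 1) c * \<eta> ^ (2 * q + 1) * (\<beta> i / fact (2 * (q - i) + 1)))"
  proof (intro sum.cong refl)
    fix q i :: nat assume "i \<in> {..q}"
    then have i: "2 * i + 2 * (q - i) + 1 = 2 * q + 1" "2 * i + (2 * (q - i) + 1) = 2 * q + 1" by auto
    show "2 * \<beta> i * a (2 * i) (2 * (q - i) + 1) * \<eta> ^ (2 * i + 2 * (q - i) + 1) =
      2 * F (2 * q + 1) c * \<eta> ^ (2 * q + 1) * (\<beta> i / fact (2 * (q - i) + 1))"
      unfolding a_def i by simp
  qed
  also have "\<dots> = 2 * (\<Sum>q<J. a 1 (2 * q) * \<eta> ^ (2 * q + 1))"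
    unfolding sum_distrib_left[symmetric] \<beta> by (simp add: a_def sum_distrib_left mult_ac)
  finally have 3: "(\<Sum>s<J. \<beta> s * \<eta> ^ (2 * s) * E s) = 2 * (\<Sum>q<J. a 1 (2 * q) * \<eta> ^ (2 * q + 1))" .
  have "\<bar>(\<Sum>s<J. \<beta> s * \<eta> ^ (2 * s) * D s - \<beta> s * \<eta> ^ (2 * s) * E s)\<bar> \<le> (\<Sum>s<J. 2 * \<bar>\<beta> s\<bar> * B * \<eta> ^ (2 * J + 1))"
    by (rule order_trans[OF sum_abs sum_mono]) (use 2 in auto)
  then have "\<bar>(\<Sum>s<J. \<beta> s * \<eta> ^ (2 * s) * D s) - 2 * (\<Sum>q<J. a 1 (2 * q) * \<eta> ^ (2 * q + 1))\<bar> \<le> (\<Sum>s<J. 2 * \<bar>\<beta> s\<bar> * B * \<eta> ^ (2 * J + 1))"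
    by (simp only: sum_subtractf 3)
  also have "(\<Sum>s<J. 2 * \<bar>\<beta> s\<bar> * B * \<eta> ^ (2 * J + 1)) = 2 * (\<Sum>s<J. \<bar>\<beta> s\<bar>) * B * \<eta> ^ (2 * J + 1)"
    by (simp only: sum_distrib_left sum_distrib_right)
  finally have 4: "\<bar>(\<Sum>s<J. \<beta> s * \<eta> ^ (2 * s) * D s) - 2 * (\<Sum>q<J. a 1 (2 * q) * \<eta> ^ (2 * q + 1))\<bar> \<le> 2 * (\<Sum>s<J. \<bar>\<beta> s\<bar>) * B * \<eta> ^ (2 * J + 1)" .
  have "F 1 (c - \<eta>) + F 1 (c + \<eta>) = b" by (simp add: b_def)
  moreover have "\<bar>\<eta> * b - (\<Sum>s<J. \<beta> s * \<eta> ^ (2 * s) * D s)\<bar> \<le> 2 * B * \<eta> ^ (2 * J + 1) + 2 * (\<Sum>s<J. \<bar>\<beta> s\<bar>) * B * \<eta> ^ (2 * J + 1)"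
    using 1 4 by linarith
  ultimately show ?thesis unfolding D_def by (simp add: algebra_simps)
qed

definition pow_series :: "(nat \<Rightarrow> real) \<Rightarrow> real \<Rightarrow> real" where
  "pow_series c x = (\<Sum>i. c i * x ^ i)"

text \<open>The functions that occur are analytic in the disc of radius 2 and are needed on [-1,1] only.\<close>

definition converges_disc2 :: "(nat \<Rightarrow> real) \<Rightarrow> bool" where
  "converges_disc2 c \<longleftrightarrow> (\<forall>x::real. \<bar>x\<bar> < 2 \<longrightarrow> summable (\<lambda>i. c i * x ^ i))"

lemma converges_disc2_diffs: "converges_disc2 c \<Longrightarrow> converges_disc2 (diffs c)"
  unfolding converges_disc2_def using termdiff_converges[of _ 2 c] by simp

lemma pow_series_deriv:
  assumes "converges_disc2 c" "\<bar>x\<bar> < 2"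
  shows "(pow_series c has_real_derivative pow_series (diffs c) x) (at x)"
  unfolding pow_series_def using assms(1,2) unfolding converges_disc2_def
  by (intro termdiffs_strong'[of 2]) simp_all

text \<open>For the remainder bounds: on [-1,1] a power series with larger radius is continuous.\<close>

lemma pow_series_bounded:
  assumes "converges_disc2 c"
  obtains B where "\<And>x. \<bar>x\<bar> \<le> 1 \<Longrightarrow> \<bar>pow_series c x\<bar> \<le> B"
proof -
  have "continuous_on {-1..1} (pow_series c)"
    by (intro continuous_at_imp_continuous_on ballI) (rule DERIV_isCont[OF pow_series_deriv[OF assms]], auto)
  then have "bounded (pow_series c ` {-1..1})"
    by (intro compact_imp_bounded compact_continuous_image) auto
  then obtain B where "\<forall>y\<in>pow_series c ` {-1..1}. norm y \<le> B" unfolding bounded_iff by blast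
  then have "\<bar>pow_series c x\<bar> \<le> B" if "\<bar>x\<bar> \<le> 1" for x using that by (auto simp: abs_le_iff)
  then show ?thesis using that by blast
qed

lemma converges_disc2_shift:
  assumes "converges_disc2 c" shows "converges_disc2 (\<lambda>i. c (i + k))"
  unfolding converges_disc2_def
proof (intro allI impI)
  fix x :: real assume x: "\<bar>x\<bar> < 2"
  show "summable (\<lambda>i. c (i + k) * x ^ i)"
  proof (cases "x = 0")
    case True
    then show ?thesis using powser_sums_zero sums_summable by simp
  next
    case False
    have "summable (\<lambda>i. c (i + k) * x ^ (i + k))"
      by (rule summable_ignore_initial_segment[of "\<lambda>i. c i * x ^ i"]) (use assms x in \<open>simp add: converges_disc2_def\<close>)
    then have "summable (\<lambda>i. c (i + k) * x ^ (i + k) / x ^ k)" by (rule summable_divide)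
    then show ?thesis using False by (simp add: power_add)
  qed
qed

lemma pow_series_split:
  assumes "converges_disc2 c" "\<bar>x\<bar> < 2"
  shows "pow_series c x = c 0 + c 1 * x + x\<^sup>2 * pow_series (\<lambda>i. c (i + 2)) x"
proof -
  have s: "summable (\<lambda>i. c i * x ^ i)" using assms by (simp add: converges_disc2_def)
  have s2: "summable (\<lambda>i. c (i + 2) * x ^ i)" using converges_disc2_shift[OF assms(1), of 2] assms(2) by (simp add: converges_disc2_def)
  have "pow_series c x = (\<Sum>i. c (i + 2) * x ^ (i + 2)) + (\<Sum>i<2. c i * x ^ i)"
    unfolding pow_series_def by (rule suminf_split_initial_segment[OF s])
  also have "(\<Sum>i. c (i + 2) * x ^ (i + 2)) = (\<Sum>i. x\<^sup>2 * (c (i + 2) * x ^ i))"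
    by (intro suminf_cong) (simp add: power2_eq_square)
  also have "\<dots> = x\<^sup>2 * pow_series (\<lambda>i. c (i + 2)) x"
    unfolding pow_series_def by (rule suminf_mult[OF s2])
  finally show ?thesis by (simp add: numeral_2_eq_2)
qed

lemma converges_disc2_antiderivative:
  assumes "converges_disc2 c"
  obtains C where "converges_disc2 C" "diffs C = c"
proof
  define C where "C = (\<lambda>i. if i = 0 then 0 else c (i - 1) / real i)"
  show "converges_disc2 C" unfolding converges_disc2_def
  proof (intro allI impI)
    fix x :: real assume x: "\<bar>x\<bar> < 2"
    have "summable (\<lambda>i. norm (c i * x ^ i))"
    proof (rule powser_insidea)
      show "summable (\<lambda>i. c i * ((\<bar>x\<bar> + 2) / 2) ^ i)" using assms x unfolding converges_disc2_def by auto
      show "norm x < norm ((\<bar>x\<bar> + 2) / 2)" using x by simp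
    qed
    then have s: "summable (\<lambda>i. \<bar>x\<bar> * norm (c i * x ^ i))" by (rule summable_mult)
    have "summable (\<lambda>i. C (Suc i) * x ^ Suc i)"
    proof (rule summable_comparison_test'[OF s])
      fix i :: nat
      have "norm (C (Suc i) * x ^ Suc i) = \<bar>x\<bar> * norm (c i * x ^ i) / real (Suc i)"
        by (simp add: C_def abs_mult mult_ac)
      also have "\<dots> \<le> \<bar>x\<bar> * norm (c i * x ^ i) / 1" by (intro divide_left_mono) auto
      finally show "norm (C (Suc i) * x ^ Suc i) \<le> \<bar>x\<bar> * norm (c i * x ^ i)" by simp
    qed
    then show "summable (\<lambda>i. C i * x ^ i)" by (subst (asm) summable_Suc_iff)
  qed
  show "diffs C = c" by (simp add: C_def diffs_def fun_eq_iff)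
qed

text \<open>Euler-Maclaurin: summing the cell formula over the n cells of [-1,1], with half width 1/n, every
difference across a cell telescopes to a difference between the end points 1 and -1.\<close>

lemma trapezoid_pow_series_expansion:
  assumes "converges_disc2 c"
  shows "even_expansion (\<lambda>n. trapezoid n (\<lambda>k. pow_series c (k / real n)) / real n)"
proof -
  obtain C where C: "converges_disc2 C" "diffs C = c" using converges_disc2_antiderivative[OF assms] by blast
  obtain \<beta> :: "nat \<Rightarrow> real" where \<beta>: "\<And>q. (\<Sum>i\<le>q. \<beta> i / fact (2 * (q - i) + 1)) = 1 / fact (2 * q)"
    using coth_coefficients by blast
  define F where "F = (\<lambda>j. pow_series ((diffs ^^ j) C))"
  have conv: "converges_disc2 ((diffs ^^ j) C)" for j by (induction j) (simp_all add: C(1) converges_disc2_diffs)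
  have deriv: "(F j has_real_derivative F (Suc j) x) (at x)" if "\<bar>x\<bar> \<le> 1" for j x
    unfolding F_def using pow_series_deriv[OF conv] that by simp
  have F1: "F 1 = pow_series c" by (simp add: F_def C(2))
  define e where "e = (\<lambda>s. \<beta> s * (F (2 * s) 1 - F (2 * s) (-1)) / 2)"
  have main: "(\<lambda>n. trapezoid n (\<lambda>k. pow_series c (k / real n)) / real n - (\<Sum>s<J. e s / real n ^ (2 * s)))
      \<in> O[even_sequentially](\<lambda>n. 1 / real n ^ (2 * J))" if J: "J > 0" for J
  proof -
    obtain B where B: "\<And>x. \<bar>x\<bar> \<le> 1 \<Longrightarrow> \<bar>F (2 * J + 1) x\<bar> \<le> B"
      unfolding F_def using pow_series_bounded[OF conv] by blast
    define K where "K = (2 + 2 * (\<Sum>s<J. \<bar>\<beta> s\<bar>)) * B"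
    show ?thesis
    proof (rule bigo_even_sequentiallyI[where N = 1 and C = K])
      fix n :: nat assume "n \<ge> 1"
      define \<eta> where "\<eta> = 1 / real n"
      have \<eta>: "\<eta> > 0" using \<open>n \<ge> 1\<close> by (simp add: \<eta>_def)
      have n\<eta>: "real n * \<eta> = 1" using \<open>n \<ge> 1\<close> by (simp add: \<eta>_def)
      define x where "x = (\<lambda>i. (2 * real i - real n) / real n)"
      have x01: "x 0 = -1" "x n = 1" using \<open>n \<ge> 1\<close> by (simp_all add: x_def)
      define ce where "ce = (\<lambda>i. x i + \<eta>)"
      have cx: "ce i - \<eta> = x i" "ce i + \<eta> = x (Suc i)" for i
        using \<open>n \<ge> 1\<close> by (simp_all add: ce_def x_def \<eta>_def field_simps)
      have xb: "\<bar>x i\<bar> \<le> 1" if "i \<le> n" for i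
        using that \<open>n \<ge> 1\<close> by (simp add: x_def abs_le_iff field_simps)
      have cell: "\<bar>\<eta> * (F 1 (x i) + F 1 (x (Suc i))) - (\<Sum>s<J. \<beta> s * \<eta> ^ (2 * s) * (F (2 * s) (x (Suc i)) - F (2 * s) (x i)))\<bar>
        \<le> K * \<eta> ^ (2 * J + 1)" if "i < n" for i
        using trapezoid_cell[OF deriv B _ _ \<eta> J \<beta>, of "ce i"] xb[of i] xb[of "Suc i"] that
        unfolding cx K_def by simp
      have "\<bar>\<Sum>i<n. \<eta> * (F 1 (x i) + F 1 (x (Suc i))) - (\<Sum>s<J. \<beta> s * \<eta> ^ (2 * s) * (F (2 * s) (x (Suc i)) - F (2 * s) (x i)))\<bar>
        \<le> (\<Sum>i<n. K * \<eta> ^ (2 * J + 1))"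
        by (rule order_trans[OF sum_abs sum_mono]) (use cell in auto)
      also have "(\<Sum>i<n. K * \<eta> ^ (2 * J + 1)) = K * \<eta> ^ (2 * J) * (real n * \<eta>)"
        by simp
      finally have 1: "\<bar>(\<Sum>i<n. \<eta> * (F 1 (x i) + F 1 (x (Suc i)))) - (\<Sum>i<n. \<Sum>s<J. \<beta> s * \<eta> ^ (2 * s) * (F (2 * s) (x (Suc i)) - F (2 * s) (x i)))\<bar>
        \<le> K * \<eta> ^ (2 * J)"
        by (simp add: sum_subtractf n\<eta>)
      have "(\<Sum>i<n. \<Sum>s<J. \<beta> s * \<eta> ^ (2 * s) * (F (2 * s) (x (Suc i)) - F (2 * s) (x i))) =
        (\<Sum>s<J. \<beta> s * \<eta> ^ (2 * s) * (\<Sum>i<n. F (2 * s) (x (Suc i)) - F (2 * s) (x i)))"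
        by (subst sum.swap) (simp only: sum_distrib_left)
      also have "\<dots> = 2 * (\<Sum>s<J. e s / real n ^ (2 * s))"
        unfolding sum_lessThan_telescope[of "\<lambda>i. F _ (x i)"] x01
        by (simp add: e_def sum_distrib_left \<eta>_def power_one_over)
      finally have 2: "(\<Sum>i<n. \<Sum>s<J. \<beta> s * \<eta> ^ (2 * s) * (F (2 * s) (x (Suc i)) - F (2 * s) (x i))) = 2 * (\<Sum>s<J. e s / real n ^ (2 * s))" .
      have xs: "(2 * real i + 2 - real n) / real n = x (Suc i)" "(2 * real i - real n) / real n = x i" for i
        by (simp_all add: x_def algebra_simps)
      have 3: "(\<Sum>i<n. \<eta> * (F 1 (x i) + F 1 (x (Suc i)))) = 2 * (trapezoid n (\<lambda>k. pow_series c (k / real n)) / real n)"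
        unfolding trapezoid_def F1 xs sum_divide_distrib sum_distrib_left
        by (intro sum.cong refl) (use \<open>n \<ge> 1\<close> in \<open>simp add: \<eta>_def field_simps\<close>)
      have 4: "K * \<eta> ^ (2 * J) = K * \<bar>1 / real n ^ (2 * J)\<bar>" by (simp add: \<eta>_def power_one_over)
      show "\<bar>trapezoid n (\<lambda>k. pow_series c (k / real n)) / real n - (\<Sum>s<J. e s / real n ^ (2 * s))\<bar> \<le> K * \<bar>1 / real n ^ (2 * J)\<bar>"
        using 1 unfolding 2 3 4[symmetric] by linarith
    qed
  qed
  have "(\<lambda>n. trapezoid n (\<lambda>k. pow_series c (k / real n)) / real n - (\<Sum>s<J. e s / real n ^ (2 * s)))
      \<in> O[even_sequentially](\<lambda>n. 1 / real n ^ (2 * J))" for J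
  proof (cases "J = 0")
    case True
    obtain B where B: "\<And>x. \<bar>x\<bar> \<le> 1 \<Longrightarrow> \<bar>pow_series c x\<bar> \<le> B" using pow_series_bounded[OF assms] by blast
    have "(\<lambda>n. trapezoid n (\<lambda>k. pow_series c (k / real n)) / real n) \<in> O[even_sequentially](\<lambda>n. 1)"
    proof (rule bigo_even_sequentiallyI[where N = 1 and C = B])
      fix n :: nat assume n: "n \<ge> 1"
      have "\<bar>trapezoid n (\<lambda>k. pow_series c (k / real n))\<bar> \<le> trapezoid n (\<lambda>_. B)"
        by (intro abs_trapezoid_le B) (use n in \<open>simp add: abs_le_iff field_simps\<close>)
      then show "\<bar>trapezoid n (\<lambda>k. pow_series c (k / real n)) / real n\<bar> \<le> B * \<bar>1\<bar>"
        using n by (simp add: trapezoid_const field_simps)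
    qed
    then show ?thesis using True by simp
  qed (use main in simp)
  then show ?thesis unfolding even_expansion_def by blast
qed

section \<open>Trapezoidal sums with the weight 1/(1-k^2)\<close>

text \<open>Write the series as c_0 + c_1 x + x^2 h(x). The constant gives the sum of 1/(1-k^2), the linear
part cancels by symmetry, and in the rest the factor k^2 is absorbed by k^2/(1-k^2) = 1/(1-k^2) - 1.\<close>

lemma trapezoid_pow_series_recip_step:
  assumes "converges_disc2 c" "even n" "n \<ge> 2"
  shows "real n * trapezoid n (\<lambda>k. pow_series c (k / real n) / (1 - k\<^sup>2)) =
    (c 0 * ((real n)\<^sup>2 / ((real n)\<^sup>2 - 1)) + -1 * (trapezoid n (\<lambda>k. pow_series (\<lambda>i. c (i + 2)) (k / real n)) / real n)) +
    (real n * trapezoid n (\<lambda>k. pow_series (\<lambda>i. c (i + 2)) (k / real n) / (1 - k\<^sup>2))) / (real n)\<^sup>2"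
proof -
  define \<phi> where "\<phi> = pow_series (\<lambda>i. c (i + 2))"
  have n0: "real n > 0" using assms(3) by simp
  have "trapezoid n (\<lambda>k. pow_series c (k / real n) / (1 - k\<^sup>2)) =
    trapezoid n (\<lambda>k. 1 * (c 0 * (1 / (1 - k\<^sup>2)) + c 1 / real n * (k / (1 - k\<^sup>2))) +
      1 * (1 / (real n)\<^sup>2 * (\<phi> (k / real n) / (1 - k\<^sup>2)) + - 1 / (real n)\<^sup>2 * \<phi> (k / real n)))"
  proof (rule trapezoid_cong)
    fix i assume i: "i \<le> n"
    define k where "k = 2 * real i - real n"
    have "1 - k\<^sup>2 \<noteq> 0" using even_grid_nonsingular[OF assms(2), of i] by (simp add: k_def)
    moreover have "\<bar>k / real n\<bar> < 2" using i n0 by (simp add: k_def abs_less_iff field_simps)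
    then have "pow_series c (k / real n) = c 0 + c 1 * (k / real n) + (k / real n)\<^sup>2 * \<phi> (k / real n)"
      unfolding \<phi>_def by (rule pow_series_split[OF assms(1)])
    ultimately have "pow_series c (k / real n) / (1 - k\<^sup>2) = 1 * (c 0 * (1 / (1 - k\<^sup>2)) + c 1 / real n * (k / (1 - k\<^sup>2))) +
      1 * (1 / (real n)\<^sup>2 * (\<phi> (k / real n) / (1 - k\<^sup>2)) + - 1 / (real n)\<^sup>2 * \<phi> (k / real n))"
      using n0 by (simp add: divide_simps power_divide) (simp add: algebra_simps power2_eq_square)
    then show "pow_series c ((2 * real i - real n) / real n) / (1 - (2 * real i - real n)\<^sup>2) =
      1 * (c 0 * (1 / (1 - (2 * real i - real n)\<^sup>2)) + c 1 / real n * ((2 * real i - real n) / (1 - (2 * real i - real n)\<^sup>2))) +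
      1 * (1 / (real n)\<^sup>2 * (\<phi> ((2 * real i - real n) / real n) / (1 - (2 * real i - real n)\<^sup>2)) + - 1 / (real n)\<^sup>2 * \<phi> ((2 * real i - real n) / real n))"
      unfolding k_def .
  qed
  also have "\<dots> = c 0 * (real n / ((real n)\<^sup>2 - 1)) + c 1 / real n * trapezoid n (\<lambda>k. k / (1 - k\<^sup>2)) +
      (1 / (real n)\<^sup>2 * trapezoid n (\<lambda>k. \<phi> (k / real n) / (1 - k\<^sup>2)) + - 1 / (real n)\<^sup>2 * trapezoid n (\<lambda>k. \<phi> (k / real n)))"
    unfolding trapezoid_lincomb trapezoid_recip[OF assms(2,3)] by (simp only: mult_1_left)
  also have "trapezoid n (\<lambda>k. k / (1 - k\<^sup>2)) = 0"
  proof -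
    have "trapezoid n (\<lambda>k. k / (1 - k\<^sup>2)) = trapezoid n (\<lambda>k. -1 * (k / (1 - k\<^sup>2)))"
      using trapezoid_reflect[of n "\<lambda>k. k / (1 - k\<^sup>2)"] by simp
    then show ?thesis unfolding trapezoid_cmult by simp
  qed
  finally show ?thesis using n0 unfolding \<phi>_def[symmetric]
    by (simp add: distrib_left right_diff_distrib power2_eq_square)
qed

text \<open>The preceding step, iterated over the series with the first 2i coefficients removed.\<close>

lemma trapezoid_pow_series_recip_expansion:
  assumes "converges_disc2 c"
  shows "even_expansion (\<lambda>n. real n * trapezoid n (\<lambda>k. pow_series c (k / real n) / (1 - k\<^sup>2)))"
proof -
  define G where "G = (\<lambda>i n. real n * trapezoid n (\<lambda>k. pow_series (\<lambda>j. c (j + 2 * i)) (k / real n) / (1 - k\<^sup>2)))"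
  define A where "A = (\<lambda>i n. c (2 * i) * ((real n)\<^sup>2 / ((real n)\<^sup>2 - 1)) + -1 * (trapezoid n (\<lambda>k. pow_series (\<lambda>j. c (j + 2 * Suc i)) (k / real n)) / real n))"
  have conv: "converges_disc2 (\<lambda>j. c (j + 2 * i))" for i by (rule converges_disc2_shift[OF assms])
  have "even_expansion (G 0)"
  proof (rule even_expansion_chain[where A = A and N = 2])
    fix i n :: nat assume "even n" "n \<ge> 2"
    have "(\<lambda>j. c (j + 2 + 2 * i)) = (\<lambda>j. c (j + 2 * Suc i))" by (simp add: add_ac)
    then show "G i n = A i n + G (Suc i) n / (real n)\<^sup>2"
      using trapezoid_pow_series_recip_step[OF conv[of i] \<open>even n\<close> \<open>n \<ge> 2\<close>] by (simp only: G_def A_def) simp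
  next
    fix i show "even_expansion (A i)" unfolding A_def
      by (intro even_expansion_lincomb even_expansion_geometric trapezoid_pow_series_expansion conv)
  next
    fix i
    obtain B where B: "\<And>x. \<bar>x\<bar> \<le> 1 \<Longrightarrow> \<bar>pow_series (\<lambda>j. c (j + 2 * i)) x\<bar> \<le> B" using pow_series_bounded[OF conv] by blast
    have B0: "B \<ge> 0" using B[of 0] by simp
    show "G i \<in> O[even_sequentially](\<lambda>n. (real n)\<^sup>2)"
    proof (rule bigo_even_sequentiallyI[where N = 2 and C = "B * 2"])
      fix n :: nat assume n: "even n" "n \<ge> 2"
      have "\<bar>trapezoid n (\<lambda>k. pow_series (\<lambda>j. c (j + 2 * i)) (k / real n) / (1 - k\<^sup>2))\<bar> \<le> trapezoid n (\<lambda>k. B * (1 / \<bar>1 - k\<^sup>2\<bar>))"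
      proof (rule abs_trapezoid_le)
        fix m assume "m \<le> n"
        then have "\<bar>pow_series (\<lambda>j. c (j + 2 * i)) ((2 * real m - real n) / real n)\<bar> \<le> B"
          using n by (intro B) (simp add: abs_le_iff field_simps)
        then show "\<bar>pow_series (\<lambda>j. c (j + 2 * i)) ((2 * real m - real n) / real n) / (1 - (2 * real m - real n)\<^sup>2)\<bar>
          \<le> B * (1 / \<bar>1 - (2 * real m - real n)\<^sup>2\<bar>)"
          by (simp add: divide_right_mono)
      qed
      also have "\<dots> \<le> B * 2"
        unfolding trapezoid_cmult by (intro mult_left_mono trapezoid_abs_recip_le n B0)
      finally have "real n * \<bar>trapezoid n (\<lambda>k. pow_series (\<lambda>j. c (j + 2 * i)) (k / real n) / (1 - k\<^sup>2))\<bar> \<le> (real n)\<^sup>2 * (B * 2)"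
        using n B0 by (intro mult_mono) (auto simp: power2_eq_square)
      then show "\<bar>G i n\<bar> \<le> B * 2 * \<bar>(real n)\<^sup>2\<bar>" by (simp add: G_def abs_mult mult_ac)
    qed
  qed
  then show ?thesis by (simp add: G_def)
qed

section \<open>Coefficients given by a power law\<close>

lemma double_series_swap:
  fixes f :: "nat \<Rightarrow> nat \<Rightarrow> real"
  assumes bound: "\<And>l i. \<bar>f l i\<bar> \<le> u l * g i"
    and u: "summable u" "\<And>l. u l \<ge> 0" and g: "summable g" "\<And>i. g i \<ge> 0"
  shows "(\<lambda>i. \<Sum>l. f l i) sums (\<Sum>l. \<Sum>i. f l i)"
proof -
  have U: "(u has_sum suminf u) UNIV" and G: "(g has_sum suminf g) UNIV"
    by (rule norm_summable_imp_has_sum; use u g in \<open>simp add: summable_sums\<close>)+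
  have "(\<lambda>(l, i). u l * g i) summable_on UNIV \<times> UNIV"
  proof (rule summable_on_SigmaI)
    fix l show "((\<lambda>i. case (l, i) of (l, i) \<Rightarrow> u l * g i) has_sum u l * suminf g) UNIV"
      using has_sum_cmult_right[OF G, of "u l"] by simp
  next
    show "(\<lambda>l. u l * suminf g) summable_on UNIV"
      using has_sum_cmult_left[OF U] by (auto simp: summable_on_def)
  qed (use u g in auto)
  then have "(\<lambda>p. norm (case p of (l, i) \<Rightarrow> f l i)) summable_on UNIV \<times> UNIV"
    by (rule summable_on_comparison_test) (use bound in auto)
  then have s: "(\<lambda>(l, i). f l i) summable_on UNIV \<times> UNIV" by (rule Infinite_Sum.abs_summable_summable)
  then obtain S where S: "((\<lambda>(l, i). f l i) has_sum S) (UNIV \<times> UNIV)" unfolding summable_on_def by blast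
  have row: "summable (\<lambda>i. norm (f l i))" for l
    by (rule summable_comparison_test'[OF summable_mult[OF g(1), of "u l"]]) (use bound in auto)
  have col: "summable (\<lambda>l. norm (f l i))" for i
    by (rule summable_comparison_test'[OF summable_mult2[OF u(1), of "g i"]]) (use bound in auto)
  have "((\<lambda>l. \<Sum>i. f l i) has_sum S) UNIV"
    by (rule has_sum_SigmaD[OF S]) (unfold prod.case, rule norm_summable_imp_has_sum[OF row summable_sums[OF summable_norm_cancel[OF row]]])
  then have 1: "(\<lambda>l. \<Sum>i. f l i) sums S" by (rule has_sum_imp_sums)
  have "((\<lambda>(i, l). f l i) has_sum S) (UNIV \<times> UNIV)" using S by (subst has_sum_swap) simp
  then have "((\<lambda>i. \<Sum>l. f l i) has_sum S) UNIV"
    by (rule has_sum_SigmaD) (unfold prod.case, rule norm_summable_imp_has_sum[OF col summable_sums[OF summable_norm_cancel[OF col]]])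
  then have "(\<lambda>i. \<Sum>l. f l i) sums S" by (rule has_sum_imp_sums)
  then show ?thesis using sums_unique[OF 1] by simp
qed

text \<open>Up to the factor 2^(-d) this is the Hurwitz zeta function at (d, 1 + x/2).\<close>

definition hurwitz_sum :: "real \<Rightarrow> real \<Rightarrow> real" where
  "hurwitz_sum d x = (\<Sum>l. (2 * real (Suc l) + x) powr - d)"

definition hurwitz_coeff :: "real \<Rightarrow> nat \<Rightarrow> real" where
  "hurwitz_coeff d i = (\<Sum>l. (- d gchoose i) * (2 * real (Suc l)) powr (- d - real i))"

lemma summable_Suc_powr:
  assumes "d > 1" shows "summable (\<lambda>l. real (Suc l) powr - d)"
  using assms summable_real_powr_iff[of "- d"] by (subst summable_Suc_iff) simp

lemma hurwitz_sum_sums: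
  assumes d: "d > 1" and x: "\<bar>x\<bar> < 2"
  shows "(\<lambda>l. (2 * real (Suc l) + x) powr - d) sums hurwitz_sum d x"
  unfolding hurwitz_sum_def
proof (rule summable_sums, rule summable_comparison_test)
  have s: "2 - \<bar>x\<bar> > 0" using x by simp
  show "summable (\<lambda>l. ((2 - \<bar>x\<bar>) / 2) powr - d * real (Suc l) powr - d)"
    by (intro summable_mult summable_Suc_powr d)
  show "\<exists>N. \<forall>l\<ge>N. norm ((2 * real (Suc l) + x) powr - d) \<le> ((2 - \<bar>x\<bar>) / 2) powr - d * real (Suc l) powr - d"
  proof (intro exI allI impI)
    fix l :: nat
    have "(2 - \<bar>x\<bar>) / 2 * real (Suc l) \<le> (2 - \<bar>x\<bar>) * real (Suc l)"
      using s by (intro mult_right_mono) auto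
    also have "\<dots> = 2 * real (Suc l) - \<bar>x\<bar> * real (Suc l)" by (simp only: left_diff_distrib)
    finally have "(2 - \<bar>x\<bar>) / 2 * real (Suc l) \<le> 2 * real (Suc l) - \<bar>x\<bar> * real (Suc l)" .
    moreover have "\<bar>x\<bar> * real (Suc l) \<ge> \<bar>x\<bar> * 1" by (intro mult_left_mono) auto
    ultimately have "(2 - \<bar>x\<bar>) / 2 * real (Suc l) \<le> 2 * real (Suc l) + x" by linarith
    then have "(2 * real (Suc l) + x) powr - d \<le> ((2 - \<bar>x\<bar>) / 2 * real (Suc l)) powr - d"
      using d s by (intro powr_mono2') auto
    then show "norm ((2 * real (Suc l) + x) powr - d) \<le> ((2 - \<bar>x\<bar>) / 2) powr - d * real (Suc l) powr - d"
      by (subst powr_mult[symmetric]) (use s in auto)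
  qed
qed

text \<open>Each summand is expanded by the binomial series. As 2(l+1) is at least 2, the double series is
dominated by (l+1)^(-d) times the absolute binomial series at |x|/2 < 1.\<close>

lemma hurwitz_sum_power_series:
  assumes d: "d > 1" and x: "\<bar>x\<bar> < 2"
  shows "(\<lambda>i. hurwitz_coeff d i * x ^ i) sums hurwitz_sum d x"
proof -
  define f where "f = (\<lambda>l i. (- d gchoose i) * (2 * real (Suc l)) powr (- d - real i) * x ^ i)"
  define u where "u = (\<lambda>l. real (Suc l) powr - d)"
  define g where "g = (\<lambda>i. norm ((- d gchoose i) * (\<bar>x\<bar> / 2) ^ i))"
  have "summable (\<lambda>i. (- d gchoose i) * ((\<bar>x\<bar> / 2 + 1) / 2) ^ i)"
    using x by (intro sums_summable[OF gen_binomial_real]) auto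
  then have g: "summable g" unfolding g_def
    by (rule powser_insidea) (use x in auto)
  have bound: "\<bar>f l i\<bar> \<le> u l * g i" for l i
  proof -
    have "(2 * real (Suc l)) powr (- d - real i) = (2 * real (Suc l)) powr - d / (2 * real (Suc l)) ^ i"
      by (simp add: powr_diff powr_realpow)
    also have "\<dots> \<le> (real (Suc l)) powr - d / 2 ^ i"
    proof (intro frac_le powr_mono2' power_mono)
      show "(0::real) < 2 ^ i" by simp
    qed (use d in auto)
    finally have "\<bar>- d gchoose i\<bar> * (2 * real (Suc l)) powr (- d - real i) * \<bar>x\<bar> ^ i \<le> \<bar>- d gchoose i\<bar> * ((real (Suc l)) powr - d / 2 ^ i) * \<bar>x\<bar> ^ i"
      by (intro mult_left_mono mult_right_mono) auto
    then show ?thesis by (simp add: f_def u_def g_def abs_mult power_abs power_divide mult_ac)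
  qed
  have "(\<lambda>i. \<Sum>l. f l i) sums (\<Sum>l. \<Sum>i. f l i)"
    by (rule double_series_swap[OF bound]) (use summable_Suc_powr[OF d] g in \<open>auto simp: u_def g_def\<close>)
  moreover have "(\<Sum>l. f l i) = hurwitz_coeff d i * x ^ i" for i
  proof -
    have "summable (\<lambda>l. (- d gchoose i) * (2 * real (Suc l)) powr (- d - real i))"
    proof -
      have "summable (\<lambda>l. (- d gchoose i) * (2 powr (- d - real i)) * real (Suc l) powr - (d + real i))"
        by (intro summable_mult summable_Suc_powr) (use d in auto)
      then show ?thesis by (simp add: powr_mult mult_ac del: of_nat_Suc)
    qed
    from suminf_mult2[OF this, of "x ^ i"] show ?thesis by (simp only: f_def hurwitz_coeff_def)
  qed
  moreover have "(\<Sum>i. f l i) = (2 * real (Suc l) + x) powr - d" for l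
    unfolding f_def using x by (intro sums_unique[symmetric] gen_binomial_real'') auto
  ultimately show ?thesis by (simp add: hurwitz_sum_def)
qed

lemma converges_disc2_hurwitz: "d > 1 \<Longrightarrow> converges_disc2 (hurwitz_coeff d)"
  unfolding converges_disc2_def by (auto intro: sums_summable[OF hurwitz_sum_power_series])

lemma pow_series_hurwitz: "d > 1 \<Longrightarrow> \<bar>x\<bar> < 2 \<Longrightarrow> pow_series (hurwitz_coeff d) x = hurwitz_sum d x"
  unfolding pow_series_def by (rule sums_unique[OF hurwitz_sum_power_series, symmetric])

lemma trapezoid_sums:
  assumes "\<And>i. i \<le> n \<Longrightarrow> (\<lambda>l. f l (2 * real i - real n)) sums F (2 * real i - real n)"
  shows "(\<lambda>l. trapezoid n (f l)) sums trapezoid n F"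
  unfolding trapezoid_def
proof (intro sums_sum sums_divide sums_add)
  fix i assume "i \<in> {..<n}"
  then show "(\<lambda>l. f l (2 * real i - real n)) sums F (2 * real i - real n)"
    "(\<lambda>l. f l (2 * real i + 2 - real n)) sums F (2 * real i + 2 - real n)"
    using assms[of i] assms[of "Suc i"] by (simp_all add: algebra_simps)
qed

text \<open>The degree that aliases to k in the l-th block, which is centred at 2n(l+1). The block around 0 is
left out because the rule is exact there.\<close>

definition alias_degree :: "nat \<Rightarrow> nat \<Rightarrow> real \<Rightarrow> real" where
  "alias_degree n l k = 2 * real n * real (Suc l) + k"

lemma alias_degree_grid:
  assumes "i \<le> n"
  shows "alias_degree n l (2 * real i - real n) = real (n * (2 * l + 1) + 2 * i)"
  by (simp add: alias_degree_def algebra_simps)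

lemma alias_degree_powr_sums:
  assumes "d > 1" "i \<le> n" "n > 0"
  shows "(\<lambda>l. alias_degree n l (2 * real i - real n) powr - d) sums
    (real n powr - d * pow_series (hurwitz_coeff d) ((2 * real i - real n) / real n))"
proof -
  define x where "x = (2 * real i - real n) / real n"
  have x: "\<bar>x\<bar> < 2" using assms by (simp add: x_def abs_less_iff field_simps)
  have "alias_degree n l (2 * real i - real n) = real n * (2 * real (Suc l) + x)" for l
    using assms(3) by (simp add: alias_degree_def x_def field_simps)
  moreover have "2 * real (Suc l) + x > 0" for l using x by (simp add: abs_less_iff)
  ultimately have "alias_degree n l (2 * real i - real n) powr - d = real n powr - d * (2 * real (Suc l) + x) powr - d" for l
    by (simp add: powr_mult less_imp_le)
  then show ?thesis using sums_mult[OF hurwitz_sum_sums[OF assms(1) x], of "real n powr - d"]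
    by (simp add: pow_series_hurwitz[OF assms(1) x] flip: x_def)
qed

lemma trapezoid_alias_degree_powr_sums:
  assumes "d > 1" "n > 0"
  shows "(\<lambda>l. trapezoid n (\<lambda>k. alias_degree n l k powr - d)) sums
    (real n powr - d * trapezoid n (\<lambda>k. pow_series (hurwitz_coeff d) (k / real n)))"
proof -
  have "(\<lambda>l. trapezoid n (\<lambda>k. alias_degree n l k powr - d)) sums
    trapezoid n (\<lambda>k. real n powr - d * pow_series (hurwitz_coeff d) (k / real n))"
    using assms by (intro trapezoid_sums alias_degree_powr_sums) auto
  then show ?thesis by (simp only: trapezoid_cmult)
qed

lemma trapezoid_alias_degree_powr_recip_sums:
  assumes "d > 1" "n > 0"
  shows "(\<lambda>l. trapezoid n (\<lambda>k. alias_degree n l k powr - d / (1 - k\<^sup>2))) sums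
    (real n powr - d * trapezoid n (\<lambda>k. pow_series (hurwitz_coeff d) (k / real n) / (1 - k\<^sup>2)))"
proof -
  have "(\<lambda>l. trapezoid n (\<lambda>k. alias_degree n l k powr - d / (1 - k\<^sup>2))) sums
    trapezoid n (\<lambda>k. real n powr - d * pow_series (hurwitz_coeff d) (k / real n) / (1 - k\<^sup>2))"
    using assms by (intro trapezoid_sums sums_divide alias_degree_powr_sums) auto
  then show ?thesis by (simp only: trapezoid_cmult times_divide_eq_right[symmetric])
qed

text \<open>The last part is 1/(1-m^2) = m^(-2) (1/(1-m^2) - 1), the step that raises the exponent d by 2.\<close>

lemma alias_degree_tail_bound:
  assumes "n \<ge> 2" "i \<le> n" "m = alias_degree n l (2 * real i - real n)"
  shows "m \<ge> real n" "m\<^sup>2 \<ge> 4" "\<bar>m powr - d / (1 - m\<^sup>2)\<bar> \<le> 2 * m powr - (d + 2)"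
    "m powr - d / (1 - m\<^sup>2) = -1 * m powr - (d + 2) + 1 * (m powr - (d + 2) / (1 - m\<^sup>2))"
proof -
  show m: "m \<ge> real n" unfolding assms(3) alias_degree_grid[OF assms(2)] by (simp only: of_nat_le_iff) simp
  then have "m \<ge> 2" using assms(1) by simp
  then show m4: "m\<^sup>2 \<ge> 4" using power_mono[of 2 m 2] by simp
  have "m powr (- d - 2) = m powr - d / m powr 2" by (rule powr_diff)
  also have "m powr 2 = m\<^sup>2" using \<open>m \<ge> 2\<close> powr_realpow[of m 2] by simp
  finally have p: "m powr - (d + 2) = m powr - d / m\<^sup>2" by (simp add: algebra_simps)
  define q where "q = m\<^sup>2"
  have q: "q \<ge> 4" using m4 by (simp add: q_def)
  have "1 / (q - 1) \<le> 2 / q" using q by (simp add: divide_simps)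
  then have "m powr - d * (1 / (q - 1)) \<le> m powr - d * (2 / q)" by (intro mult_left_mono) auto
  moreover have "\<bar>m powr - d / (1 - q)\<bar> = m powr - d * (1 / (q - 1))" using q by (simp add: abs_mult)
  ultimately show "\<bar>m powr - d / (1 - m\<^sup>2)\<bar> \<le> 2 * m powr - (d + 2)"
    unfolding p q_def[symmetric] by (simp only: times_divide_eq_right) (simp add: mult_ac)
  show "m powr - d / (1 - m\<^sup>2) = -1 * m powr - (d + 2) + 1 * (m powr - (d + 2) / (1 - m\<^sup>2))"
    unfolding p q_def[symmetric] using q by (simp add: divide_simps) (simp add: algebra_simps)
qed

text \<open>The part of the folded series that comes from the integrals 2/(1-m^2).\<close>

definition tail_sum :: "real \<Rightarrow> nat \<Rightarrow> real" where
  "tail_sum d n = (\<Sum>l. trapezoid n (\<lambda>k. alias_degree n l k powr - d / (1 - (alias_degree n l k)\<^sup>2)))"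

lemma tail_sum_bound:
  assumes "d > 0" "n \<ge> 2"
  shows "(\<lambda>l. trapezoid n (\<lambda>k. alias_degree n l k powr - d / (1 - (alias_degree n l k)\<^sup>2))) sums tail_sum d n" (is ?s)
    and "\<bar>tail_sum d n\<bar> \<le> 2 * (real n powr - (d + 2) * trapezoid n (\<lambda>k. pow_series (hurwitz_coeff (d + 2)) (k / real n)))" (is ?b)
proof -
  have sm: "(\<lambda>l. 2 * trapezoid n (\<lambda>k. alias_degree n l k powr - (d + 2))) sums
     (2 * (real n powr - (d + 2) * trapezoid n (\<lambda>k. pow_series (hurwitz_coeff (d + 2)) (k / real n))))"
    using assms by (intro sums_mult trapezoid_alias_degree_powr_sums) auto
  have le: "\<bar>trapezoid n (\<lambda>k. alias_degree n l k powr - d / (1 - (alias_degree n l k)\<^sup>2))\<bar> \<le> 2 * trapezoid n (\<lambda>k. alias_degree n l k powr - (d + 2))" for l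
    unfolding trapezoid_cmult[symmetric] using assms(2) by (intro abs_trapezoid_le alias_degree_tail_bound(3)) auto
  have summ: "summable (\<lambda>l. \<bar>trapezoid n (\<lambda>k. alias_degree n l k powr - d / (1 - (alias_degree n l k)\<^sup>2))\<bar>)"
    by (rule summable_comparison_test'[OF sums_summable[OF sm]]) (simp only: real_norm_def abs_idempotent le)
  then show ?s unfolding tail_sum_def by (rule summable_sums[OF summable_rabs_cancel])
  have "\<bar>tail_sum d n\<bar> \<le> (\<Sum>l. \<bar>trapezoid n (\<lambda>k. alias_degree n l k powr - d / (1 - (alias_degree n l k)\<^sup>2))\<bar>)"
    unfolding tail_sum_def by (rule summable_rabs[OF summ])
  also have "\<dots> \<le> (\<Sum>l. 2 * trapezoid n (\<lambda>k. alias_degree n l k powr - (d + 2)))"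
    by (intro suminf_le le summ sums_summable[OF sm])
  also have "\<dots> = 2 * (real n powr - (d + 2) * trapezoid n (\<lambda>k. pow_series (hurwitz_coeff (d + 2)) (k / real n)))"
    by (rule sums_unique[OF sm, symmetric])
  finally show ?b .
qed

lemma tail_sum_step:
  assumes "d > 0" "n \<ge> 2"
  shows "tail_sum d n = - (real n powr - (d + 2) * trapezoid n (\<lambda>k. pow_series (hurwitz_coeff (d + 2)) (k / real n))) + tail_sum (d + 2) n"
proof -
  have "trapezoid n (\<lambda>k. alias_degree n l k powr - d / (1 - (alias_degree n l k)\<^sup>2)) =
    -1 * trapezoid n (\<lambda>k. alias_degree n l k powr - (d + 2)) + 1 * trapezoid n (\<lambda>k. alias_degree n l k powr - (d + 2) / (1 - (alias_degree n l k)\<^sup>2))" for l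
    unfolding trapezoid_lincomb[symmetric] using assms(2) by (intro trapezoid_cong alias_degree_tail_bound(4)) auto
  moreover have "(\<lambda>l. -1 * trapezoid n (\<lambda>k. alias_degree n l k powr - (d + 2)) + 1 * trapezoid n (\<lambda>k. alias_degree n l k powr - (d + 2) / (1 - (alias_degree n l k)\<^sup>2)))
    sums (-1 * (real n powr - (d + 2) * trapezoid n (\<lambda>k. pow_series (hurwitz_coeff (d + 2)) (k / real n))) + 1 * tail_sum (d + 2) n)"
    using assms by (intro sums_add sums_mult trapezoid_alias_degree_powr_sums tail_sum_bound(1)) auto
  ultimately have "(\<lambda>l. trapezoid n (\<lambda>k. alias_degree n l k powr - d / (1 - (alias_degree n l k)\<^sup>2))) sums
    (-1 * (real n powr - (d + 2) * trapezoid n (\<lambda>k. pow_series (hurwitz_coeff (d + 2)) (k / real n))) + 1 * tail_sum (d + 2) n)"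
    by simp
  from sums_unique2[OF tail_sum_bound(1)[OF assms] this] show ?thesis by linarith
qed

text \<open>Raising d by 2 gains n^(-2) after rescaling by n^(d+1), so the recursion in d has the form required by
\<open>even_expansion_chain\<close>, with unweighted trapezoidal sums as inhomogeneous terms.\<close>

lemma tail_sum_expansion:
  assumes "d > 0"
  shows "even_expansion (\<lambda>n. real n powr (d + 1) * tail_sum d n)"
proof -
  define G where "G = (\<lambda>i n. real n powr (d + 2 * real i + 1) * tail_sum (d + 2 * real i) n)"
  define S where "S = (\<lambda>i n. trapezoid n (\<lambda>k. pow_series (hurwitz_coeff (d + 2 * real i + 2)) (k / real n)) / real n)"
  have S: "even_expansion (S i)" for i
    unfolding S_def using assms by (intro trapezoid_pow_series_expansion converges_disc2_hurwitz) simp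
  have pw: "real n powr (d' + 1) * real n powr - (d' + 2) = 1 / real n" if "n \<ge> 2" for d' n
    using that by (simp add: powr_add[symmetric] powr_minus divide_inverse)
  have "even_expansion (G 0)"
  proof (rule even_expansion_chain[where A = "\<lambda>i n. -1 * S i n + 0 * S i n" and N = 2])
    fix i n :: nat assume n: "n \<ge> 2"
    define d' where "d' = d + 2 * real i"
    have d': "d' > 0" "d + 2 * real (Suc i) = d' + 2" using assms by (simp_all add: d'_def)
    have "real n powr (d' + 2 + 1) = real n powr (d' + 1) * real n powr 2"
      by (subst powr_add[symmetric]) (simp only: add.assoc add.commute[of 2 1])
    also have "real n powr 2 = (real n)\<^sup>2" using n powr_realpow[of "real n" 2] by simp
    finally have pp: "real n powr (d' + 2 + 1) = real n powr (d' + 1) * (real n)\<^sup>2" .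
    have G1: "real n powr (d' + 1) * tail_sum (d' + 2) n = G (Suc i) n / (real n)\<^sup>2"
    proof -
      have "G (Suc i) n = real n powr (d' + 2 + 1) * tail_sum (d' + 2) n" by (simp only: G_def d'(2))
      then show ?thesis unfolding pp using n by simp
    qed
    have "G i n = real n powr (d' + 1) * tail_sum d' n" by (simp add: G_def d'_def)
    also have "\<dots> = - (real n powr (d' + 1) * real n powr - (d' + 2)) * trapezoid n (\<lambda>k. pow_series (hurwitz_coeff (d' + 2)) (k / real n))
       + real n powr (d' + 1) * tail_sum (d' + 2) n"
      unfolding tail_sum_step[OF d'(1) n] by (simp add: algebra_simps)
    finally show "G i n = (-1 * S i n + 0 * S i n) + G (Suc i) n / (real n)\<^sup>2"
      unfolding pw[OF n] G1 by (simp add: S_def d'_def)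
  next
    fix i show "even_expansion (\<lambda>n. -1 * S i n + 0 * S i n)" by (intro even_expansion_lincomb S)
    have "(\<lambda>n. 2 * S i n) \<in> O[even_sequentially](\<lambda>n. 1)" using even_expansion_bounded[OF S] by simp
    moreover have "G i \<in> O[even_sequentially](\<lambda>n. 2 * S i n)"
    proof (rule bigo_even_sequentiallyI[where N = 2 and C = 1])
      fix n :: nat assume n: "n \<ge> 2"
      define d' where "d' = d + 2 * real i"
      have d': "d' > 0" using assms by (simp add: d'_def)
      have "\<bar>G i n\<bar> = real n powr (d' + 1) * \<bar>tail_sum d' n\<bar>" by (simp add: G_def d'_def abs_mult)
      also have "\<dots> \<le> real n powr (d' + 1) * (2 * (real n powr - (d' + 2) * trapezoid n (\<lambda>k. pow_series (hurwitz_coeff (d' + 2)) (k / real n))))"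
        by (intro mult_left_mono tail_sum_bound(2) d' n) auto
      also have "\<dots> = 2 * (real n powr (d' + 1) * real n powr - (d' + 2)) * trapezoid n (\<lambda>k. pow_series (hurwitz_coeff (d' + 2)) (k / real n))"
        by (simp only: mult_ac)
      also have "\<dots> = 2 * S i n" unfolding pw[OF n] by (simp add: S_def d'_def)
      finally show "\<bar>G i n\<bar> \<le> 1 * \<bar>2 * S i n\<bar>" by simp
    qed
    ultimately have "G i \<in> O[even_sequentially](\<lambda>n. 1)" by (rule landau_o.big_trans[rotated])
    moreover have "(\<lambda>n. 1) \<in> O[even_sequentially](\<lambda>n. (real n)\<^sup>2)"
      by (rule bigo_even_sequentiallyI[where N = 1 and C = 1]) simp
    ultimately show "G i \<in> O[even_sequentially](\<lambda>n. (real n)\<^sup>2)" by (rule landau_o.big_trans)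
  qed
  then show ?thesis by (simp add: G_def)
qed

text \<open>The contribution of the l-th block of degrees to the error, for coefficients interpolated by A.
Neighbouring blocks share an end term, of which each counts one half.\<close>

definition fold_term :: "nat \<Rightarrow> (real \<Rightarrow> real) \<Rightarrow> nat \<Rightarrow> real" where
  "fold_term n A l = trapezoid n (\<lambda>k. A (alias_degree n l k) * (2 / (1 - (alias_degree n l k)\<^sup>2) - 2 / (1 - k\<^sup>2)))"

lemma fold_term_powr_expansion:
  assumes "d > 1"
  shows "even_expansion (\<lambda>n. real n powr (d + 1) * (\<Sum>l. fold_term n (\<lambda>x. x powr - d) l))"
proof -
  define T where "T = (\<lambda>n. trapezoid n (\<lambda>k. pow_series (hurwitz_coeff d) (k / real n) / (1 - k\<^sup>2)))"
  have "even_expansion (\<lambda>n. 2 * (real n powr (d + 1) * tail_sum d n) + -2 * (real n * T n))"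
    unfolding T_def using assms by (intro even_expansion_lincomb tail_sum_expansion trapezoid_pow_series_recip_expansion converges_disc2_hurwitz) auto
  also have "?this \<longleftrightarrow> ?thesis"
  proof (rule even_expansion_cong[where N = 2])
    fix n :: nat assume n: "n \<ge> 2"
    have "fold_term n (\<lambda>x. x powr - d) l = 2 * trapezoid n (\<lambda>k. alias_degree n l k powr - d / (1 - (alias_degree n l k)\<^sup>2)) +
      -2 * trapezoid n (\<lambda>k. alias_degree n l k powr - d / (1 - k\<^sup>2))" for l
      unfolding trapezoid_lincomb[symmetric] fold_term_def by (intro trapezoid_cong) (simp add: right_diff_distrib mult.commute)
    moreover have "(\<lambda>l. 2 * trapezoid n (\<lambda>k. alias_degree n l k powr - d / (1 - (alias_degree n l k)\<^sup>2)) +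
      -2 * trapezoid n (\<lambda>k. alias_degree n l k powr - d / (1 - k\<^sup>2))) sums (2 * tail_sum d n + -2 * (real n powr - d * T n))"
      unfolding T_def using assms n
      by (intro sums_add sums_mult trapezoid_alias_degree_powr_recip_sums tail_sum_bound(1)) auto
    ultimately have "(\<lambda>l. fold_term n (\<lambda>x. x powr - d) l) sums (2 * tail_sum d n + -2 * (real n powr - d * T n))"
      by simp
    then have "(\<Sum>l. fold_term n (\<lambda>x. x powr - d) l) = 2 * tail_sum d n + -2 * (real n powr - d * T n)"
      by (rule sums_unique[symmetric])
    moreover have "real n powr (d + 1) * real n powr - d = real n"
      using n by (simp add: powr_add[symmetric])
    moreover have "2 * (q * t) + -2 * (q * p * T) = q * (2 * t + -2 * (p * T))" for p q t T :: real
      by (simp add: algebra_simps)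
    ultimately show "2 * (real n powr (d + 1) * tail_sum d n) + -2 * (real n * T n) =
       real n powr (d + 1) * (\<Sum>l. fold_term n (\<lambda>x. x powr - d) l)"
      by metis
  qed
  finally show ?thesis .
qed

text \<open>Only the trivial bounds m \<ge> n(l+1) and |1-m^2| \<ge> |1-k^2| are used; the sum over k stays bounded because
that of 1/|1-k^2| does.\<close>

lemma fold_term_bound:
  assumes M: "M > 1" and n: "even n" "n \<ge> 2" and B: "B \<ge> 0"
    and A: "\<And>m. even m \<Longrightarrow> m \<ge> n \<Longrightarrow> \<bar>A (real m)\<bar> \<le> B * real m powr - M"
  shows "summable (fold_term n A)"
    and "\<bar>\<Sum>l. fold_term n A l\<bar> \<le> 8 * (\<Sum>l. real (Suc l) powr - M) * B * real n powr - M"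
proof -
  define b where "b = (\<lambda>l. 8 * B * real n powr - M * real (Suc l) powr - M)"
  have sb: "summable b" unfolding b_def by (intro summable_mult summable_Suc_powr M)
  have le: "\<bar>fold_term n A l\<bar> \<le> b l" for l
  proof -
    have "\<bar>fold_term n A l\<bar> \<le> trapezoid n (\<lambda>k. (4 * B * real n powr - M * real (Suc l) powr - M) * (1 / \<bar>1 - k\<^sup>2\<bar>))"
      unfolding fold_term_def
    proof (rule abs_trapezoid_le)
      fix i assume i: "i \<le> n"
      \<comment> \<open>m is the degree that aliases to k in block l.\<close>
      define k where "k = 2 * real i - real n"
      define m where "m = n * (2 * l + 1) + 2 * i"
      have sh: "alias_degree n l k = real m" unfolding k_def m_def by (rule alias_degree_grid[OF i])
      have m: "even m" "m \<ge> n" "m \<ge> n * Suc l" using n by (simp_all add: m_def)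
      have "\<bar>A (real m)\<bar> \<le> B * real m powr - M" by (rule A[OF m(1,2)])
      also have "\<dots> \<le> B * (real n * real (Suc l)) powr - M"
        unfolding of_nat_mult[symmetric] using m(3) n M B
        by (intro mult_left_mono powr_mono2') (auto simp del: of_nat_mult of_nat_Suc mult_Suc_right)
      also have "\<dots> = B * real n powr - M * real (Suc l) powr - M" by (simp add: powr_mult mult_ac)
      finally have 1: "\<bar>A (real m)\<bar> \<le> B * real n powr - M * real (Suc l) powr - M" .
      have k1: "\<bar>1 - k\<^sup>2\<bar> > 0" using even_grid_nonsingular[OF n(1), of i] by (simp add: k_def)
      have "\<bar>k\<bar> \<le> \<bar>real m\<bar>" using i m(2) by (simp add: k_def abs_le_iff)
      then have km: "k\<^sup>2 \<le> (real m)\<^sup>2" by (simp only: abs_le_square_iff)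
      have m4: "(real m)\<^sup>2 \<ge> 4" using m(2) n(2) power_mono[of 2 "real m" 2] by simp
      have "\<bar>1 - k\<^sup>2\<bar> \<le> \<bar>1 - (real m)\<^sup>2\<bar>" using km m4 zero_le_power2[of k] by linarith
      then have "2 / \<bar>1 - (real m)\<^sup>2\<bar> \<le> 2 / \<bar>1 - k\<^sup>2\<bar>" using k1 by (intro divide_left_mono) (auto intro!: mult_pos_pos)
      then have 2: "\<bar>2 / (1 - (real m)\<^sup>2) - 2 / (1 - k\<^sup>2)\<bar> \<le> 4 * (1 / \<bar>1 - k\<^sup>2\<bar>)"
        using abs_triangle_ineq4[of "2 / (1 - (real m)\<^sup>2)" "2 / (1 - k\<^sup>2)"] by (simp add: abs_divide)
      have "\<bar>A (real m)\<bar> * \<bar>2 / (1 - (real m)\<^sup>2) - 2 / (1 - k\<^sup>2)\<bar> \<le> (B * real n powr - M * real (Suc l) powr - M) * (4 * (1 / \<bar>1 - k\<^sup>2\<bar>))"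
        using B by (intro mult_mono 1 2) auto
      then show "\<bar>A (alias_degree n l (2 * real i - real n)) *
          (2 / (1 - (alias_degree n l (2 * real i - real n))\<^sup>2) - 2 / (1 - (2 * real i - real n)\<^sup>2))\<bar>
         \<le> 4 * B * real n powr - M * real (Suc l) powr - M * (1 / \<bar>1 - (2 * real i - real n)\<^sup>2\<bar>)"
        unfolding k_def[symmetric] sh abs_mult by (simp add: mult_ac)
    qed
    also have "\<dots> \<le> (4 * B * real n powr - M * real (Suc l) powr - M) * 2"
      unfolding trapezoid_cmult using B by (intro mult_left_mono trapezoid_abs_recip_le n) auto
    finally show ?thesis by (simp add: b_def)
  qed
  have sa: "summable (\<lambda>l. \<bar>fold_term n A l\<bar>)"
    by (rule summable_comparison_test'[OF sb]) (use le in simp)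
  then show "summable (fold_term n A)" by (rule summable_rabs_cancel)
  have "\<bar>\<Sum>l. fold_term n A l\<bar> \<le> (\<Sum>l. \<bar>fold_term n A l\<bar>)" by (rule summable_rabs[OF sa])
  also have "\<dots> \<le> suminf b" by (intro suminf_le le sa sb)
  also have "\<dots> = 8 * B * real n powr - M * (\<Sum>l. real (Suc l) powr - M)"
    unfolding b_def by (intro suminf_mult summable_Suc_powr M)
  finally show "\<bar>\<Sum>l. fold_term n A l\<bar> \<le> 8 * (\<Sum>l. real (Suc l) powr - M) * B * real n powr - M"
    by (simp add: mult_ac)
qed

section \<open>The quadrature error of a Chebyshev polynomial\<close>

text \<open>Halving the end terms is the same as averaging over cells, which makes cosine sums telescope.\<close>

lemma sum_cc_delta:
  assumes "n > 0"
  shows "(\<Sum>j = 0..n. cc_delta n j * g j) = (\<Sum>j<n. (g j + g (Suc j)) / 2)"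
proof -
  obtain m where n: "n = Suc m" using assms gr0_implies_Suc by blast
  have "(\<Sum>j<n. (g j + g (Suc j)) / 2) = ((\<Sum>j<Suc m. g j) + (\<Sum>j<Suc m. g (Suc j))) / 2"
    by (simp only: n sum_divide_distrib[symmetric] sum.distrib)
  also have "(\<Sum>j<Suc m. g j) = g 0 + (\<Sum>j<m. g (Suc j))" by (rule sum.lessThan_Suc_shift)
  also have "(\<Sum>j<Suc m. g (Suc j)) = (\<Sum>j<m. g (Suc j)) + g n" by (simp add: n)
  finally have 1: "(\<Sum>j<n. (g j + g (Suc j)) / 2) = g 0 / 2 + g n / 2 + (\<Sum>j<m. g (Suc j))"
    by (simp add: field_simps)
  have "(\<Sum>j = 0..n. cc_delta n j * g j) = (\<Sum>j<Suc (Suc m). cc_delta n j * g j)"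
    by (simp add: n atLeast0AtMost lessThan_Suc_atMost)
  also have "\<dots> = cc_delta n 0 * g 0 + (\<Sum>j<Suc m. cc_delta n (Suc j) * g (Suc j))"
    by (rule sum.lessThan_Suc_shift)
  also have "(\<Sum>j<Suc m. cc_delta n (Suc j) * g (Suc j)) = (\<Sum>j<m. cc_delta n (Suc j) * g (Suc j)) + cc_delta n n * g n"
    by (simp add: n)
  also have "(\<Sum>j<m. cc_delta n (Suc j) * g (Suc j)) = (\<Sum>j<m. g (Suc j))"
    by (intro sum.cong refl) (simp add: cc_delta_def n)
  finally show ?thesis unfolding 1 by (simp add: cc_delta_def)
qed

text \<open>Discrete orthogonality. With \<theta> = q \<pi>/n, multiplying a cell by 2 sin(\<theta>/2) gives cos(\<theta>/2) times a
difference of sines, and sin(n \<theta>) = 0.\<close>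

lemma cos_trapezoid_sum:
  fixes q :: int
  assumes "n > 0"
  shows "(\<Sum>j = 0..n. cc_delta n j * cos (real_of_int q * (real j * pi / real n))) =
    (if 2 * int n dvd q then real n else 0)"
proof (cases "2 * int n dvd q")
  case True
  then obtain c where c: "q = 2 * int n * c" by blast
  have one: "cos (real_of_int q * (real j * pi / real n)) = 1" for j
  proof -
    have "real_of_int q * (real j * pi / real n) = 2 * pi * of_int (int j * c)" using assms by (simp add: c)
    then show ?thesis by (simp only: cos_int_2pin)
  qed
  show ?thesis unfolding one using True sum_cc_delta[OF assms, of "\<lambda>_. 1"] by simp
next
  case False
  define \<theta> where "\<theta> = real_of_int q * pi / real n"
  have th: "real_of_int q * (real j * pi / real n) = real j * \<theta>" for j by (simp add: \<theta>_def)
  have "sin (\<theta> / 2) \<noteq> 0"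
  proof
    assume "sin (\<theta> / 2) = 0"
    then obtain i :: int where "\<theta> / 2 = of_int i * pi" unfolding sin_zero_iff_int2 by blast
    then have "real_of_int q = 2 * real n * of_int i" using assms by (simp add: \<theta>_def field_simps)
    then have "real_of_int q = real_of_int (2 * int n * i)" by simp
    then have "q = 2 * int n * i" by (simp only: of_int_eq_iff)
    then show False using False by simp
  qed
  have cell: "2 * sin (\<theta> / 2) * ((cos (real j * \<theta>) + cos (real (Suc j) * \<theta>)) / 2) = cos (\<theta> / 2) * (sin (real (Suc j) * \<theta>) - sin (real j * \<theta>))" for j
  proof -
    define u v where "u = (real j + 1 / 2) * \<theta>" and "v = \<theta> / 2"
    have uv: "real j * \<theta> = u - v" "real (Suc j) * \<theta> = u + v" by (simp_all add: u_def v_def algebra_simps)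
    show ?thesis unfolding uv v_def[symmetric] cos_add cos_diff sin_add sin_diff by (simp add: algebra_simps)
  qed
  have "2 * sin (\<theta> / 2) * (\<Sum>j = 0..n. cc_delta n j * cos (real j * \<theta>)) = (\<Sum>j<n. cos (\<theta> / 2) * (sin (real (Suc j) * \<theta>) - sin (real j * \<theta>)))"
    unfolding sum_cc_delta[OF assms] sum_distrib_left cell ..
  also have "\<dots> = cos (\<theta> / 2) * (sin (real n * \<theta>) - sin (real 0 * \<theta>))"
    unfolding sum_distrib_left[symmetric] by (subst sum_lessThan_telescope) simp
  also have "real n * \<theta> = pi * of_int q" using assms by (simp add: \<theta>_def)
  finally show ?thesis unfolding th using \<open>sin (\<theta> / 2) \<noteq> 0\<close> False by simp
qed

text \<open>The rule applied to T_q for an integer q, with the values of T_q at the nodes written as cosines.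
Allowing negative q makes aliasing and reflection simple shifts of q.\<close>

definition cc_cos :: "nat \<Rightarrow> int \<Rightarrow> real" where
  "cc_cos n q = (\<Sum>j = 0..n. cc_weight n j * cos (real_of_int q * (real j * pi / real n)))"

lemma cc_cos_eq:
  assumes "n > 0"
  shows "cc_cos n q = (\<Sum>p = 0..n div 2. 2 * cc_delta n (2 * p) / (1 - 4 * (real p)\<^sup>2) *
    ((if 2 * int n dvd 2 * int p + q then 1 else 0) + (if 2 * int n dvd 2 * int p - q then 1 else 0)))"
proof -
  define c where "c = (\<lambda>p. cc_delta n (2 * p) / (1 - 4 * (real p)\<^sup>2))"
  define x where "x = (\<lambda>j. real j * pi / real n)"
  have "cc_cos n q = (\<Sum>j = 0..n. \<Sum>p = 0..n div 2. 4 / real n * c p * (cc_delta n j * (cos (2 * real p * x j) * cos (of_int q * x j))))"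
    unfolding cc_cos_def cc_weight_def
    by (simp add: sum_distrib_left sum_distrib_right c_def x_def mult_ac)
  also have "\<dots> = (\<Sum>p = 0..n div 2. 4 / real n * c p * (\<Sum>j = 0..n. cc_delta n j * (cos (2 * real p * x j) * cos (of_int q * x j))))"
    by (subst sum.swap) (simp only: sum_distrib_left)
  also have "\<dots> = (\<Sum>p = 0..n div 2. 4 / real n * c p * (real n / 2 *
    ((if 2 * int n dvd 2 * int p + q then 1 else 0) + (if 2 * int n dvd 2 * int p - q then 1 else 0))))"
  proof (intro sum.cong refl arg_cong2[where f = "(*)"])
    fix p
    have "(\<Sum>j = 0..n. cc_delta n j * (cos (2 * real p * x j) * cos (of_int q * x j))) =
      (\<Sum>j = 0..n. cc_delta n j * cos (of_int (2 * int p + q) * x j) / 2 + cc_delta n j * cos (of_int (2 * int p - q) * x j) / 2)"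
    proof (intro sum.cong refl)
      fix j
      have split: "of_int (2 * int p + q) * x j = 2 * real p * x j + of_int q * x j"
        "of_int (2 * int p - q) * x j = 2 * real p * x j - of_int q * x j"
        by (simp_all add: distrib_right left_diff_distrib)
      show "cc_delta n j * (cos (2 * real p * x j) * cos (of_int q * x j)) =
        cc_delta n j * cos (of_int (2 * int p + q) * x j) / 2 + cc_delta n j * cos (of_int (2 * int p - q) * x j) / 2"
        unfolding split cos_times_cos by (simp add: distrib_left add_divide_distrib)
    qed
    also have "\<dots> = (if 2 * int n dvd 2 * int p + q then real n else 0) / 2 + (if 2 * int n dvd 2 * int p - q then real n else 0) / 2"
      unfolding sum.distrib sum_divide_distrib[symmetric] x_def cos_trapezoid_sum[OF assms] ..
    finally show "(\<Sum>j = 0..n. cc_delta n j * (cos (2 * real p * x j) * cos (of_int q * x j))) =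
       real n / 2 * ((if 2 * int n dvd 2 * int p + q then 1 else 0) + (if 2 * int n dvd 2 * int p - q then 1 else 0))"
      by simp
  qed
  also have "\<dots> = (\<Sum>p = 0..n div 2. 2 * cc_delta n (2 * p) / (1 - 4 * (real p)\<^sup>2) *
    ((if 2 * int n dvd 2 * int p + q then 1 else 0) + (if 2 * int n dvd 2 * int p - q then 1 else 0)))"
  proof (intro sum.cong refl)
    fix p
    have a: "2 * cc_delta n (2 * p) / (1 - 4 * (real p)\<^sup>2) = 2 * c p" by (simp add: c_def)
    have b: "4 / real n * c p * (real n / 2 * z) = 2 * c p * z" for z using assms by simp
    show "4 / real n * c p * (real n / 2 * ((if 2 * int n dvd 2 * int p + q then 1 else 0) + (if 2 * int n dvd 2 * int p - q then 1 else 0))) =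
      2 * cc_delta n (2 * p) / (1 - 4 * (real p)\<^sup>2) * ((if 2 * int n dvd 2 * int p + q then 1 else 0) + (if 2 * int n dvd 2 * int p - q then 1 else 0))"
      unfolding a by (rule b)
  qed
  finally show ?thesis .
qed

lemma cc_cos_odd:
  assumes "n > 0" "odd q" shows "cc_cos n q = 0"
proof -
  have "\<not> 2 * int n dvd 2 * int p + q" "\<not> 2 * int n dvd 2 * int p - q" for p
    using dvd_mult_left[of 2 "int n" "2 * int p + q"] dvd_mult_left[of 2 "int n" "2 * int p - q"] assms(2) by auto
  then show ?thesis unfolding cc_cos_eq[OF assms(1)] by simp
qed

text \<open>Exactness on even degrees 2r \<le> n. Orthogonality leaves the term p = r. For r = 0 and r = n/2 it
is counted twice, which compensates for the halved factor \<delta> there.\<close>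

lemma cc_cos_even:
  assumes "even n" "n > 0" "2 * r \<le> n"
  shows "cc_cos n (int (2 * r)) = 2 / (1 - 4 * (real r)\<^sup>2)"
proof -
  obtain N where N: "n = 2 * N" using assms(1) by blast
  have r: "r \<le> N" and N0: "N > 0" using assms N by auto
  have plus: "2 * int n dvd 2 * int p + int (2 * r) \<longleftrightarrow> p = r \<and> (r = 0 \<or> r = N)" if "p \<le> N" for p
  proof
    assume "2 * int n dvd 2 * int p + int (2 * r)"
    then have "int (2 * (2 * N)) dvd int (2 * (p + r))" unfolding N by simp
    then have "2 * (2 * N) dvd 2 * (p + r)" by (simp only: int_dvd_int_iff)
    then have "2 * N dvd p + r" by (simp only: nat_mult_dvd_cancel1 zero_less_numeral)
    then obtain c where c: "p + r = 2 * N * c" by blast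
    have "c < 2"
    proof (rule ccontr)
      assume "\<not> c < 2"
      then have "2 * N * c \<ge> 2 * N * 2" by (intro mult_le_mono) auto
      then show False using c that r N0 by linarith
    qed
    then have "c = 0 \<or> c = 1" by linarith
    then show "p = r \<and> (r = 0 \<or> r = N)" using c that r by auto
  qed (auto simp: N)
  have minus: "2 * int n dvd 2 * int p - int (2 * r) \<longleftrightarrow> p = r" if "p \<le> N" for p
  proof
    assume "2 * int n dvd 2 * int p - int (2 * r)"
    then have "2 * (2 * int N) dvd 2 * (int p - int r)" unfolding N by (simp add: right_diff_distrib)
    then have "2 * int N dvd int p - int r" by (simp only: dvd_mult_cancel_left) simp
    moreover have "\<bar>int p - int r\<bar> < 2 * int N" using that r N0 by linarith
    ultimately have "int p - int r = 0" using dvd_imp_le_int[of "int p - int r" "2 * int N"] by linarith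
    then show "p = r" by simp
  qed simp
  have "cc_cos n (int (2 * r)) = (\<Sum>p = 0..n div 2. if p = r then 2 * cc_delta n (2 * r) / (1 - 4 * (real r)\<^sup>2) *
     ((if r = 0 \<or> r = N then 1 else 0) + 1) else 0)"
    unfolding cc_cos_eq[OF assms(2)]
  proof (intro sum.cong refl)
    fix p assume "p \<in> {0..n div 2}"
    then have p: "p \<le> N" by (simp add: N)
    show "2 * cc_delta n (2 * p) / (1 - 4 * (real p)\<^sup>2) *
      ((if 2 * int n dvd 2 * int p + int (2 * r) then 1 else 0) + (if 2 * int n dvd 2 * int p - int (2 * r) then 1 else 0)) =
      (if p = r then 2 * cc_delta n (2 * r) / (1 - 4 * (real r)\<^sup>2) * ((if r = 0 \<or> r = N then 1 else 0) + 1) else 0)"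
      unfolding plus[OF p] minus[OF p] by simp
  qed
  also have "\<dots> = 2 * cc_delta n (2 * r) / (1 - 4 * (real r)\<^sup>2) * ((if r = 0 \<or> r = N then 1 else 0) + 1)"
    using r by (simp add: N)
  also have "\<dots> = 2 / (1 - 4 * (real r)\<^sup>2)"
    by (simp add: cc_delta_def N)
  finally show ?thesis .
qed

definition chebT :: "nat \<Rightarrow> real \<Rightarrow> real" where
  "chebT m x = cos (real m * arccos x)"

lemma cc_quad_chebT: "n > 0 \<Longrightarrow> cc_quad n (chebT m) = cc_cos n (int m)"
proof -
  assume n: "n > 0"
  have "arccos (cc_node n j) = real j * pi / real n" if "j \<le> n" for j
    unfolding cc_node_def using that n by (intro arccos_cos) (auto simp: field_simps)
  then show ?thesis unfolding cc_quad_def cc_cos_def chebT_def by (intro sum.cong) auto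
qed

lemma cc_cos_alias: 
  assumes "n > 0" shows "cc_cos n (2 * int n * c + q) = cc_cos n q"
  unfolding cc_cos_def
proof (intro sum.cong refl arg_cong2[where f = "(*)"])
  fix j
  have "real_of_int (2 * int n * c + q) * (real j * pi / real n) = real_of_int q * (real j * pi / real n) + 2 * pi * of_int (c * int j)"
    using assms by (simp add: field_simps)
  then show "cos (real_of_int (2 * int n * c + q) * (real j * pi / real n)) = cos (real_of_int q * (real j * pi / real n))"
    by (simp only: cos_add cos_int_2pin sin_int_2pin mult_zero_right mult_1_right diff_zero)
qed

lemma cc_cos_minus: "cc_cos n (- q) = cc_cos n q"
  by (simp add: cc_cos_def)

text \<open>The antiderivative (T_(m+1)/(m+1) - T_(m-1)/(m-1))/2 is undefined for m = 1, where the integrand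
is x.\<close>

lemma integral_chebT:
  "(chebT m has_integral (if even m then 2 / (1 - (real m)\<^sup>2) else 0)) {-1..1}"
proof (cases "m = 1")
  case True
  have "((\<lambda>x. x) has_integral (1\<^sup>2 - (-1)\<^sup>2) / 2) {-1..1::real}"
    using ident_has_integral[of "-1" 1] by simp
  then have "((\<lambda>x::real. x) has_integral 0) {-1..1}" by simp
  then have "(chebT m has_integral 0) {-1..1}"
    by (rule has_integral_eq[rotated]) (auto simp: chebT_def True)
  then show ?thesis using True by simp
next
  case False
  define a b where "a = real m + 1" and "b = real m - 1"
  have nz: "a \<noteq> 0" "b \<noteq> 0" using False by (auto simp: a_def b_def)
  define F where "F = (\<lambda>x. (cos (a * arccos x) / a - cos (b * arccos x) / b) / 2)"
  have "(chebT m has_integral F 1 - F (-1)) {-1..1}"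
  proof (rule fundamental_theorem_of_calculus_interior)
    show "continuous_on {-1..1} F" unfolding F_def using nz by (auto intro!: continuous_intros)
    fix x :: real assume x: "x \<in> {-1<..<1}"
    let ?t = "arccos x"
    have st: "sin ?t = sqrt (1 - x\<^sup>2)" using x by (simp add: sin_arccos)
    have st0: "sin ?t \<noteq> 0" using x by (intro sin_arccos_nonzero) auto
    have dt: "(arccos has_real_derivative inverse (- sin ?t)) (at x)"
      unfolding st using x by (intro DERIV_arccos) auto
    have dc: "((\<lambda>x. cos (c * arccos x)) has_real_derivative - sin (c * ?t) * (c * inverse (- sin ?t))) (at x)" for c
      by (rule DERIV_chain2[OF DERIV_cos DERIV_cmult[OF dt]])
    have "(F has_real_derivative (- sin (a * ?t) * (a * inverse (- sin ?t)) / a - - sin (b * ?t) * (b * inverse (- sin ?t)) / b) / 2) (at x)"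
      unfolding F_def by (intro DERIV_cdivide DERIV_diff dc)
    also have "(- sin (a * ?t) * (a * inverse (- sin ?t)) / a - - sin (b * ?t) * (b * inverse (- sin ?t)) / b) / 2 = (sin (a * ?t) - sin (b * ?t)) / (2 * sin ?t)"
      using nz st0 by (simp add: field_simps)
    also have "sin (a * ?t) - sin (b * ?t) = 2 * cos (real m * ?t) * sin ?t"
      by (simp add: a_def b_def distrib_right left_diff_distrib sin_add sin_diff)
    finally show "(F has_vector_derivative chebT m x) (at x)"
      using st0 by (simp add: has_real_derivative_iff_has_vector_derivative chebT_def)
  qed simp
  moreover have "F 1 - F (-1) = (if even m then 2 / (1 - (real m)\<^sup>2) else 0)"
  proof -
    have "cos (a * pi) = - cos (real m * pi)" "cos (b * pi) = - cos (real m * pi)"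
      by (simp_all add: a_def b_def distrib_right left_diff_distrib cos_add cos_diff)
    then have "F 1 - F (-1) = (1 / a - 1 / b) * (1 + cos (real m * pi)) / 2"
      unfolding F_def using nz by (simp add: field_simps)
    also have "1 / a - 1 / b = 2 / (1 - (real m)\<^sup>2)"
    proof -
      have "1 - (real m)\<^sup>2 = - (a * b)" by (simp add: a_def b_def power2_eq_square algebra_simps)
      moreover have "1 / a - 1 / b = (b - a) / (a * b)" using nz by (simp add: field_simps)
      moreover have "b - a = -2" by (simp add: a_def b_def)
      ultimately show ?thesis by simp
    qed
    also have "cos (real m * pi) = (-1) ^ m" by simp
    finally have "F 1 - F (-1) = 2 / (1 - (real m)\<^sup>2) * (1 + (-1) ^ m) / 2" .
    moreover have "z * (1 + (-1) ^ m) / 2 = (if even m then z else 0)" for z :: real by (cases "even m") auto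
    ultimately show ?thesis by (simp only:)
  qed
  ultimately show ?thesis by simp
qed

lemma cc_error_chebT_odd: "n > 0 \<Longrightarrow> odd m \<Longrightarrow> cc_error n (chebT m) = 0"
  unfolding cc_error_def using integral_unique[OF integral_chebT[of m]]
  by (simp add: cc_quad_chebT cc_cos_odd)

text \<open>The degrees m and k have the same values at the nodes, and the rule is exact for |k| \<le> n. With
c = 0 this also covers m \<le> n, where the error is zero.\<close>

lemma cc_error_chebT_even:
  assumes n: "even n" "n > 0" and k: "even k" "\<bar>k\<bar> \<le> int n" and m: "int m = 2 * int n * c + k"
  shows "cc_error n (chebT m) = 2 / (1 - (real m)\<^sup>2) - 2 / (1 - (real_of_int k)\<^sup>2)"
proof -
  obtain k' where k': "k = 2 * k'" using k(1) by blast
  define r where "r = nat \<bar>k'\<bar>"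
  have kr: "\<bar>k\<bar> = int (2 * r)" by (simp add: k' r_def abs_mult)
  have "cc_cos n (int m) = cc_cos n k" unfolding m by (rule cc_cos_alias[OF n(2)])
  also have "\<dots> = cc_cos n \<bar>k\<bar>" by (simp add: abs_if cc_cos_minus)
  also have "\<dots> = 2 / (1 - 4 * (real r)\<^sup>2)" unfolding kr by (rule cc_cos_even) (use n k(2) kr in auto)
  also have "4 * (real r)\<^sup>2 = (real_of_int k)\<^sup>2"
  proof -
    have "(real_of_int k)\<^sup>2 = real_of_int (\<bar>k\<bar>\<^sup>2)" by simp
    then show ?thesis unfolding kr by (simp add: power_mult_distrib)
  qed
  finally have "cc_cos n (int m) = 2 / (1 - (real_of_int k)\<^sup>2)" .
  moreover have "even m" using arg_cong[OF m, of even] k(1) by simp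
  ultimately show ?thesis
    unfolding cc_error_def cc_quad_chebT[OF n(2)] using integral_unique[OF integral_chebT[of m]] by simp
qed

text \<open>Regrouping: only even degrees from n on matter. Averaging each of them with its successor changes
nothing, because the first one contributes zero, and the averages are then collected in blocks of n.\<close>

lemma sums_fold:
  fixes g :: "nat \<Rightarrow> real"
  assumes s: "g sums S" and n: "even n" "n > 0"
    and odd: "\<And>m. odd m \<Longrightarrow> g m = 0"
    and low: "\<And>m. m \<le> n \<Longrightarrow> g m = 0"
    and val: "\<And>l i. i \<le> n \<Longrightarrow> g (n * (2 * l + 1) + 2 * i) = A (alias_degree n l (2 * real i - real n)) *
      (2 / (1 - (alias_degree n l (2 * real i - real n))\<^sup>2) - 2 / (1 - (2 * real i - real n)\<^sup>2))"
  shows "fold_term n A sums S"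
proof -
  define h where "h = (\<lambda>j. g (n + 2 * j))"
  have "h sums S" unfolding h_def
  proof (subst sums_mono_reindex[where f = g])
    fix m assume m: "m \<notin> range (\<lambda>j. n + 2 * j)"
    show "g m = 0"
    proof (rule ccontr)
      assume "g m \<noteq> 0"
      then have "even m" "m > n" using odd low by (auto simp: not_le[symmetric])
      then have "even (m - n)" using n by simp
      then obtain j where "m - n = 2 * j" by blast
      then have "m = n + 2 * j" using \<open>m > n\<close> by simp
      then show False using m by blast
    qed
  qed (use s in \<open>auto simp: strict_mono_def\<close>)
  moreover have h0: "h 0 = 0" using low[of n] by (simp add: h_def)
  ultimately have "(\<lambda>j. h (Suc j)) sums S" by (subst sums_Suc_iff) simp
  then have "(\<lambda>j. (h j + h (Suc j)) / 2) sums ((S + S) / 2)"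
    using \<open>h sums S\<close> by (intro sums_divide sums_add)
  then have "(\<lambda>j. (h j + h (Suc j)) / 2) sums S" by simp
  from sums_group[OF this n(2)]
  have "(\<lambda>l. \<Sum>j = l * n..<l * n + n. (h j + h (Suc j)) / 2) sums S" .
  moreover have "(\<Sum>j = l * n..<l * n + n. (h j + h (Suc j)) / 2) = fold_term n A l" for l
  proof -
    have hval: "h (i + l * n) = A (alias_degree n l (2 * real i - real n)) *
      (2 / (1 - (alias_degree n l (2 * real i - real n))\<^sup>2) - 2 / (1 - (2 * real i - real n)\<^sup>2))" if "i \<le> n" for i
    proof -
      have eq: "n + 2 * (i + l * n) = n * (2 * l + 1) + 2 * i" by (simp add: algebra_simps)
      show ?thesis unfolding h_def eq by (rule val[OF that])
    qed
    have "(\<Sum>j = l * n..<l * n + n. (h j + h (Suc j)) / 2) = (\<Sum>i = 0..<n. (h (i + l * n) + h (Suc i + l * n)) / 2)"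
      using sum.shift_bounds_nat_ivl[of "\<lambda>j. (h j + h (Suc j)) / 2" 0 "l * n" n] by (simp add: add.commute)
    also have "\<dots> = fold_term n A l" unfolding fold_term_def trapezoid_def atLeast0LessThan
    proof (intro sum.cong refl)
      fix i assume "i \<in> {..<n}"
      then have i: "i \<le> n" "Suc i \<le> n" by auto
      have sc: "2 * real (Suc i) - real n = 2 * real i + 2 - real n" by simp
      show "(h (i + l * n) + h (Suc i + l * n)) / 2 =
        (A (alias_degree n l (2 * real i - real n)) * (2 / (1 - (alias_degree n l (2 * real i - real n))\<^sup>2) - 2 / (1 - (2 * real i - real n)\<^sup>2)) +
         A (alias_degree n l (2 * real i + 2 - real n)) * (2 / (1 - (alias_degree n l (2 * real i + 2 - real n))\<^sup>2) - 2 / (1 - (2 * real i + 2 - real n)\<^sup>2))) / 2"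
        unfolding hval[OF i(1)] hval[OF i(2)] sc ..
    qed
    finally show ?thesis .
  qed
  ultimately show ?thesis by simp
qed

section \<open>The quadrature error as a folded series of Chebyshev coefficients\<close>

lemma integral_of_dominated_series:
  fixes g :: "nat \<Rightarrow> real \<Rightarrow> real"
  assumes cont: "\<And>m. continuous_on {a..b} (g m)"
    and bound: "\<And>m t. t \<in> {a..b} \<Longrightarrow> \<bar>g m t\<bar> \<le> M m" and M: "summable M"
  shows "(\<lambda>m. integral {a..b} (g m)) sums integral {a..b} (\<lambda>t. \<Sum>m. g m t)"
    and "continuous_on {a..b} (\<lambda>t. \<Sum>m. g m t)"
proof -
  have u: "uniform_limit {a..b} (\<lambda>N t. \<Sum>m<N. g m t) (\<lambda>t. \<Sum>m. g m t) sequentially"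
    by (rule Weierstrass_m_test[OF _ M]) (use bound in auto)
  have c: "continuous_on {a..b} (\<lambda>t. \<Sum>m<N. g m t)" for N
    by (intro continuous_on_sum cont)
  obtain I J where IJ: "\<And>N. ((\<lambda>t. \<Sum>m<N. g m t) has_integral I N) {a..b}"
    "((\<lambda>t. \<Sum>m. g m t) has_integral J) {a..b}" "I \<longlonglongrightarrow> J"
    using uniform_limit_integral[OF u c sequentially_bot] by blast
  have "I N = (\<Sum>m<N. integral {a..b} (g m))" for N
    using integral_unique[OF IJ(1)[of N]] integral_sum[of "{..<N}" g "{a..b}"] integrable_continuous_real[OF cont]
    by simp
  then have "I = (\<lambda>N. \<Sum>m<N. integral {a..b} (g m))" by blast
  then show "(\<lambda>m. integral {a..b} (g m)) sums integral {a..b} (\<lambda>t. \<Sum>m. g m t)"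
    using IJ(3) integral_unique[OF IJ(2)] by (simp add: sums_def)
  show "continuous_on {a..b} (\<lambda>t. \<Sum>m. g m t)"
    by (rule uniform_limit_theorem[OF _ u]) (use c in auto)
qed

lemma integral_cos_int:
  fixes q :: int
  shows "((\<lambda>t. cos (of_int q * t)) has_integral (if q = 0 then pi else 0)) {0..pi}"
proof (cases "q = 0")
  case True
  then show ?thesis using has_integral_const_real[of "1::real" 0 pi] by simp
next
  case False
  have "((\<lambda>t. cos (of_int q * t)) has_integral sin (of_int q * pi) / of_int q - sin (of_int q * 0) / of_int q) {0..pi}"
  proof (rule fundamental_theorem_of_calculus)
    fix t :: real
    have "((\<lambda>t. sin (of_int q * t) / of_int q) has_real_derivative cos (of_int q * t) * (of_int q * 1) / of_int q) (at t within {0..pi})"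
      by (intro DERIV_cdivide DERIV_chain2[OF DERIV_sin] DERIV_cmult DERIV_ident)
    then show "((\<lambda>t. sin (of_int q * t) / of_int q) has_vector_derivative cos (of_int q * t)) (at t within {0..pi})"
      using False by (simp add: has_real_derivative_iff_has_vector_derivative)
  qed simp
  moreover have "sin (of_int q * pi) = 0" using sin_npi_int[of q] by (simp add: mult.commute)
  ultimately show ?thesis using False by simp
qed

lemma integral_cos_cos:
  "integral {0..pi} (\<lambda>t. cos (real m * t) * cos (real n * t)) = (if m = n then if n = 0 then pi else pi / 2 else 0)"
proof -
  have "((\<lambda>t. (cos (of_int (int m - int n) * t) + cos (of_int (int m + int n) * t)) / 2) has_integral
     ((if int m - int n = 0 then pi else 0) + (if int m + int n = 0 then pi else 0)) / 2) {0..pi}"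
    by (intro has_integral_divide has_integral_add integral_cos_int)
  moreover have "(cos (of_int (int m - int n) * t) + cos (of_int (int m + int n) * t)) / 2 = cos (real m * t) * cos (real n * t)" for t
    unfolding cos_times_cos by (simp add: left_diff_distrib distrib_right)
  ultimately have "((\<lambda>t. cos (real m * t) * cos (real n * t)) has_integral
     ((if int m - int n = 0 then pi else 0) + (if int m + int n = 0 then pi else 0)) / 2) {0..pi}" by simp
  from integral_unique[OF this] show ?thesis by auto
qed

lemma continuous_on_cos_arg:
  assumes "continuous_on {-1..1} f" shows "continuous_on {0..pi} (\<lambda>t. f (cos t :: real))"
  by (rule continuous_on_compose2[OF assms]) (auto intro!: continuous_intros)

text \<open>If all cosine moments of h(cos t) vanish then so do its moments against polynomials in cos t, and by
Weierstrass h is a uniform limit of polynomials; so the square of h(cos t) has integral zero.\<close>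

lemma cosine_moments_zero:
  fixes h :: "real \<Rightarrow> real"
  assumes cont: "continuous_on {-1..1} h"
    and zero: "\<And>n. integral {0..pi} (\<lambda>t. h (cos t) * cos (real n * t)) = 0"
    and x: "x \<in> {-1..1}"
  shows "h x = 0"
proof -
  have ch: "continuous_on {0..pi} (\<lambda>t. h (cos t))" by (rule continuous_on_cos_arg[OF cont])
  have int: "(\<lambda>t. h (cos t) * g t) integrable_on {0..pi}" if "continuous_on {0..pi} g" for g
    by (intro integrable_continuous_real continuous_on_mult ch that)
  have mom: "integral {0..pi} (\<lambda>t. h (cos t) * (cos t ^ i * cos (real n * t))) = 0" for i n
  proof (induction i arbitrary: n)
    case (Suc i)
    obtain k where k: "cos t * cos (real n * t) = (cos (real (Suc n) * t) + cos (real k * t)) / 2" for t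
    proof (cases n)
      case 0
      then show ?thesis using that[of 1] by simp
    next
      case (Suc l)
      have "cos t * cos (real n * t) = (cos (real (Suc n) * t) + cos (real l * t)) / 2" for t
        using cos_times_cos[of "real n * t" t] by (simp add: Suc algebra_simps)
      then show ?thesis using that by blast
    qed
    have "integral {0..pi} (\<lambda>t. h (cos t) * (cos t ^ Suc i * cos (real n * t))) =
      integral {0..pi} (\<lambda>t. (h (cos t) * (cos t ^ i * cos (real (Suc n) * t)) + h (cos t) * (cos t ^ i * cos (real k * t))) / 2)"
    proof (rule integral_cong)
      fix t
      have eq: "cos t ^ Suc i * cos (real n * t) = cos t ^ i * ((cos (real (Suc n) * t) + cos (real k * t)) / 2)"
        unfolding k[symmetric] by simp
      show "h (cos t) * (cos t ^ Suc i * cos (real n * t)) =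
        (h (cos t) * (cos t ^ i * cos (real (Suc n) * t)) + h (cos t) * (cos t ^ i * cos (real k * t))) / 2"
        unfolding eq by (simp only: distrib_left times_divide_eq_right)
    qed
    also have "\<dots> = 0"
      unfolding integral_divide
      by (subst integral_add) (intro int continuous_intros, intro int continuous_intros, simp add: Suc.IH del: of_nat_Suc)
    finally show ?case .
  qed (simp add: zero)
  obtain B where B: "\<And>t. t \<in> {0..pi} \<Longrightarrow> \<bar>h (cos t)\<bar> \<le> B"
  proof -
    have "bounded ((\<lambda>t. h (cos t)) ` {0..pi})"
      by (intro compact_imp_bounded compact_continuous_image ch) simp
    then obtain B where "\<forall>y\<in>(\<lambda>t. h (cos t)) ` {0..pi}. norm y \<le> B" unfolding bounded_iff by blast
    then show ?thesis by (intro that[of B]) auto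
  qed
  have B0: "B \<ge> 0" using B[of 0] by simp
  define I where "I = integral {0..pi} (\<lambda>t. h (cos t) * h (cos t))"
  have small: "I \<le> B * e * pi" if e: "e > 0" for e
  proof -
    obtain p where p: "real_polynomial_function p" "\<And>x. x \<in> {-1..1} \<Longrightarrow> \<bar>h x - p x\<bar> < e"
      using Stone_Weierstrass_real_polynomial_function[OF _ cont e] by auto
    obtain a N where pa: "p = (\<lambda>x. \<Sum>i\<le>N. a i * x ^ i)"
      using p(1) unfolding real_polynomial_function_iff_sum by blast
    have cp: "continuous_on {0..pi} (\<lambda>t. p (cos t))" unfolding pa by (intro continuous_intros)
    have "integral {0..pi} (\<lambda>t. h (cos t) * p (cos t)) = integral {0..pi} (\<lambda>t. \<Sum>i\<le>N. h (cos t) * (cos t ^ i * cos (real 0 * t)) * a i)"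
      by (intro integral_cong) (simp add: pa sum_distrib_left mult_ac)
    also have "\<dots> = (\<Sum>i\<le>N. integral {0..pi} (\<lambda>t. h (cos t) * (cos t ^ i * cos (real 0 * t)) * a i))"
      by (intro integral_sum finite_atMost integrable_on_mult_left int continuous_intros)
    also have "\<dots> = 0" by (simp only: integral_mult_left mom) simp
    finally have hp: "integral {0..pi} (\<lambda>t. h (cos t) * p (cos t)) = 0" .
    have "I = integral {0..pi} (\<lambda>t. h (cos t) * h (cos t)) - integral {0..pi} (\<lambda>t. h (cos t) * p (cos t))"
      by (simp add: I_def hp)
    also have "\<dots> = integral {0..pi} (\<lambda>t. h (cos t) * h (cos t) - h (cos t) * p (cos t))"
      by (rule integral_diff[symmetric]) (intro int ch cp)+
    also have "\<dots> \<le> integral {0..pi} (\<lambda>t. B * e)"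
    proof (rule integral_le)
      fix t assume t: "t \<in> {0..pi}"
      have "h (cos t) * h (cos t) - h (cos t) * p (cos t) \<le> \<bar>h (cos t)\<bar> * \<bar>h (cos t) - p (cos t)\<bar>"
        by (metis abs_ge_self abs_mult right_diff_distrib)
      also have "\<dots> \<le> B * e" using B[OF t] p(2)[of "cos t"] B0 e by (intro mult_mono) auto
      finally show "h (cos t) * h (cos t) - h (cos t) * p (cos t) \<le> B * e" .
    qed (intro integrable_diff int ch cp integrable_const_ivl)+
    also have "\<dots> = B * e * pi" by simp
    finally show ?thesis .
  qed
  have "I \<le> 0"
  proof (rule ccontr)
    assume "\<not> I \<le> 0"
    then have I: "I > 0" by simp
    \<comment> \<open>With this choice of e the bound is less than I/2; B + 1 avoids division by zero.\<close>
    have "I \<le> B * (I / (2 * (B + 1) * pi)) * pi" using I B0 by (intro small) (auto intro!: divide_pos_pos mult_pos_pos)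
    also have "\<dots> = I * (B / (2 * (B + 1)))" by simp
    also have "\<dots> < I * 1" using I B0 by (intro mult_strict_left_mono) (auto simp: divide_less_eq)
    finally show False by simp
  qed
  moreover have "I \<ge> 0" unfolding I_def by (intro integral_nonneg int ch) simp
  ultimately have "I = 0" by simp
  then have z: "\<forall>t\<in>{0..pi}. h (cos t) * h (cos t) = 0"
    unfolding I_def by (subst (asm) integral_eq_0_iff) (auto intro!: continuous_intros ch)
  have "arccos x \<in> {0..pi}" "cos (arccos x) = x" using x arccos_bounded[of x] by auto
  then show ?thesis using z by force
qed

text \<open>The coefficient of T_0 in the Chebyshev series is half of \<open>cheb_coeff f 0\<close>.\<close>

definition cheb_term :: "(real \<Rightarrow> real) \<Rightarrow> nat \<Rightarrow> real" where
  "cheb_term f m = (if m = 0 then cheb_coeff f 0 / 2 else cheb_coeff f m)"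

lemma continuous_on_chebT: "continuous_on {-1..1} (chebT m)"
  unfolding chebT_def by (auto intro!: continuous_intros)

text \<open>The series converges uniformly, and its sum has the same cosine moments as f.\<close>

lemma cheb_series:
  assumes cont: "continuous_on {-1..1} f" and summ: "summable (\<lambda>m. \<bar>cheb_coeff f m\<bar>)"
    and x: "x \<in> {-1..1}"
  shows "(\<lambda>m. cheb_term f m * chebT m x) sums f x"
proof -
  define c where "c = cheb_term f"
  have sc: "summable (\<lambda>m. \<bar>c m\<bar>)"
    by (rule summable_comparison_test'[OF summ]) (simp add: c_def cheb_term_def)
  have le: "\<bar>c m * chebT m x\<bar> \<le> \<bar>c m\<bar>" for m x
    unfolding abs_mult chebT_def by (rule mult_left_le) auto
  define S where "S = (\<lambda>x. \<Sum>m. c m * chebT m x)"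
  have cS: "continuous_on {-1..1} S" unfolding S_def
    by (rule integral_of_dominated_series(2)[OF _ _ sc]) (use le continuous_on_chebT in \<open>auto intro!: continuous_intros\<close>)
  have "f x - S x = 0"
  proof (rule cosine_moments_zero[where h = "\<lambda>x. f x - S x", OF _ _ x])
    show "continuous_on {-1..1} (\<lambda>x. f x - S x)" by (intro continuous_intros cont cS)
    fix n
    \<comment> \<open>The moments of S are computed term by term; only m = n survives.\<close>
    define g where "g = (\<lambda>m t. c m * (cos (real m * t) * cos (real n * t)))"
    have "(\<lambda>m. integral {0..pi} (g m)) sums integral {0..pi} (\<lambda>t. \<Sum>m. g m t)"
    proof (rule integral_of_dominated_series(1)[OF _ _ sc])
      fix m t
      have "\<bar>cos (real m * t)\<bar> * \<bar>cos (real n * t)\<bar> \<le> 1 * 1" by (intro mult_mono) auto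
      then show "\<bar>g m t\<bar> \<le> \<bar>c m\<bar>" unfolding g_def abs_mult by (intro mult_left_le) auto
    qed (auto simp: g_def intro!: continuous_intros)
    then have "(\<lambda>m. if m = n then pi / 2 * cheb_coeff f n else 0) sums integral {0..pi} (\<lambda>t. \<Sum>m. g m t)"
    proof (rule back_subst[of "\<lambda>u. u sums _"])
      show "(\<lambda>m. integral {0..pi} (g m)) = (\<lambda>m. if m = n then pi / 2 * cheb_coeff f n else 0)"
        unfolding g_def integral_mult_right integral_cos_cos by (auto simp: c_def cheb_term_def)
    qed
    moreover have "(\<lambda>m. if m = n then pi / 2 * cheb_coeff f n else 0) sums (pi / 2 * cheb_coeff f n)"
      using sums_single[of n "\<lambda>_. pi / 2 * cheb_coeff f n"] by simp
    ultimately have "integral {0..pi} (\<lambda>t. \<Sum>m. g m t) = pi / 2 * cheb_coeff f n"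
      by (rule sums_unique2)
    moreover have "integral {0..pi} (\<lambda>t. \<Sum>m. g m t) = integral {0..pi} (\<lambda>t. S (cos t) * cos (real n * t))"
    proof (rule integral_cong)
      fix t assume "t \<in> {0..pi}"
      then have ac: "arccos (cos t) = t" by (intro arccos_cos) auto
      have "summable (\<lambda>m. c m * chebT m (cos t))"
        by (rule summable_comparison_test'[OF sc]) (use le in simp)
      from suminf_mult2[OF this, of "cos (real n * t)"]
      show "(\<Sum>m. g m t) = S (cos t) * cos (real n * t)"
        by (simp add: S_def g_def chebT_def ac mult_ac)
    qed
    moreover have "integral {0..pi} (\<lambda>t. f (cos t) * cos (real n * t)) = pi / 2 * cheb_coeff f n"
      by (simp add: cheb_coeff_def)
    moreover have "integral {0..pi} (\<lambda>t. (f (cos t) - S (cos t)) * cos (real n * t)) =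
      integral {0..pi} (\<lambda>t. f (cos t) * cos (real n * t)) - integral {0..pi} (\<lambda>t. S (cos t) * cos (real n * t))"
      unfolding left_diff_distrib
      by (intro integral_diff integrable_continuous_real continuous_intros continuous_on_cos_arg cont cS)
    ultimately show "integral {0..pi} (\<lambda>t. (f (cos t) - S (cos t)) * cos (real n * t)) = 0" by simp
  qed
  then have "f x = S x" by simp
  moreover have "summable (\<lambda>m. c m * chebT m x)"
    by (rule summable_comparison_test'[OF sc]) (use le in simp)
  ultimately show ?thesis unfolding S_def c_def by (simp add: summable_sums)
qed

lemma cc_error_sums:
  assumes cont: "continuous_on {-1..1} f" and summ: "summable (\<lambda>m. \<bar>cheb_coeff f m\<bar>)"
  shows "(\<lambda>m. cheb_term f m * cc_error n (chebT m)) sums cc_error n f"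
proof -
  define c where "c = cheb_term f"
  have sc: "summable (\<lambda>m. \<bar>c m\<bar>)"
    by (rule summable_comparison_test'[OF summ]) (simp add: c_def cheb_term_def)
  have le: "\<bar>c m * chebT m x\<bar> \<le> \<bar>c m\<bar>" for m x
    unfolding abs_mult chebT_def by (rule mult_left_le) auto
  have "(\<lambda>m. integral {-1..1} (\<lambda>x. c m * chebT m x)) sums integral {-1..1} (\<lambda>x. \<Sum>m. c m * chebT m x)"
    by (rule integral_of_dominated_series(1)[OF _ _ sc]) (use le continuous_on_chebT in \<open>auto intro!: continuous_intros\<close>)
  also have "integral {-1..1} (\<lambda>x. \<Sum>m. c m * chebT m x) = integral {-1..1} f"
    using cheb_series[OF cont summ] by (intro integral_cong) (simp add: c_def sums_unique[symmetric])
  finally have 1: "(\<lambda>m. c m * integral {-1..1} (chebT m)) sums integral {-1..1} f" by simp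
  have node: "cc_node n j \<in> {-1..1}" for j by (simp add: cc_node_def)
  have "(\<lambda>m. \<Sum>j = 0..n. cc_weight n j * (c m * chebT m (cc_node n j))) sums cc_quad n f"
    unfolding cc_quad_def c_def by (intro sums_sum sums_mult cheb_series cont summ node)
  moreover have "(\<Sum>j = 0..n. cc_weight n j * (c m * chebT m (cc_node n j))) = c m * cc_quad n (chebT m)" for m
    by (simp add: cc_quad_def sum_distrib_left mult_ac)
  ultimately have "(\<lambda>m. c m * cc_quad n (chebT m)) sums cc_quad n f" by simp
  from sums_diff[OF 1 this] show ?thesis by (simp add: cc_error_def c_def right_diff_distrib)
qed

lemma fold_term_sums_cc_error:
  assumes cont: "continuous_on {-1..1} f" and summ: "summable (\<lambda>m. \<bar>cheb_coeff f m\<bar>)"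
    and n: "even n" "n > 0"
  shows "fold_term n (\<lambda>x. cheb_coeff f (nat \<lfloor>x\<rfloor>)) sums cc_error n f"
proof (rule sums_fold[OF cc_error_sums[OF cont summ] n])
  fix m :: nat assume "odd m"
  then show "cheb_term f m * cc_error n (chebT m) = 0" using n by (simp add: cc_error_chebT_odd)
next
  fix m :: nat assume "m \<le> n"
  show "cheb_term f m * cc_error n (chebT m) = 0"
  proof (cases "even m")
    case True
    then show ?thesis using cc_error_chebT_even[OF n, of "int m" m 0] \<open>m \<le> n\<close> by simp
  qed (use n in \<open>simp add: cc_error_chebT_odd\<close>)
next
  fix l i :: nat assume i: "i \<le> n"
  define m where "m = n * (2 * l + 1) + 2 * i"
  have "cc_error n (chebT m) = 2 / (1 - (real m)\<^sup>2) - 2 / (1 - (real_of_int (2 * int i - int n))\<^sup>2)"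
    by (rule cc_error_chebT_even[OF n, where c = "int l + 1"])
       (use n i in \<open>auto simp: m_def algebra_simps\<close>)
  moreover have "m \<noteq> 0" using n by (simp add: m_def)
  ultimately have "cheb_term f m * cc_error n (chebT m) = cheb_coeff f (nat \<lfloor>real m\<rfloor>) *
    (2 / (1 - (real m)\<^sup>2) - 2 / (1 - (2 * real i - real n)\<^sup>2))"
    by (simp add: cheb_term_def)
  then show "cheb_term f (n * (2 * l + 1) + 2 * i) * cc_error n (chebT (n * (2 * l + 1) + 2 * i)) =
    cheb_coeff f (nat \<lfloor>alias_degree n l (2 * real i - real n)\<rfloor>) *
    (2 / (1 - (alias_degree n l (2 * real i - real n))\<^sup>2) - 2 / (1 - (2 * real i - real n)\<^sup>2))"
    unfolding alias_degree_grid[OF i] m_def[symmetric] .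
qed

section \<open>Continuity rules out slowly decaying coefficients\<close>

definition nat_dist :: "nat \<Rightarrow> nat \<Rightarrow> nat" where
  "nat_dist p q = (p - q) + (q - p)"

text \<open>N times the N-th Cesaro mean of the two-sided series with terms b_|k|.\<close>

definition toeplitz_sum :: "(nat \<Rightarrow> real) \<Rightarrow> nat \<Rightarrow> real" where
  "toeplitz_sum b N = (\<Sum>p<N. \<Sum>q<N. b (nat_dist p q))"

lemma toeplitz_sum_Suc:
  "toeplitz_sum b (Suc N) = toeplitz_sum b N + (b 0 + 2 * (\<Sum>k = 1..N. b k))"
proof -
  have 1: "(\<Sum>q<N. b (nat_dist N q)) = (\<Sum>k = 1..N. b k)"
    by (rule sum.reindex_bij_witness[of _ "\<lambda>k. N - k" "\<lambda>q. N - q"]) (auto simp: nat_dist_def)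
  have 2: "(\<Sum>p<N. b (nat_dist p N)) = (\<Sum>k = 1..N. b k)"
    by (rule sum.reindex_bij_witness[of _ "\<lambda>k. N - k" "\<lambda>q. N - q"]) (auto simp: nat_dist_def)
  have 3: "nat_dist N N = 0" by (simp add: nat_dist_def)
  show ?thesis
    unfolding toeplitz_sum_def by (simp add: sum.distrib 1 2 3)
qed

text \<open>If b_k is eventually at least c/k, the increments of the Toeplitz sums exceed any constant by
comparison with the harmonic series, so these sums grow faster than linearly.\<close>

lemma toeplitz_sum_unbounded:
  assumes c: "c > 0" and b: "eventually (\<lambda>k. b k \<ge> c / real k) sequentially"
    and bound: "\<And>N. \<bar>toeplitz_sum b N\<bar> \<le> C * real N"
  shows False
proof -
  obtain K where K: "\<And>k. k \<ge> K \<Longrightarrow> b k \<ge> c / real k" using b unfolding eventually_sequentially by blast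
  define E where "E = (\<Sum>k = 1..K. b k - c / real k)"
  have low: "(\<Sum>k = 1..N. b k) \<ge> E + c * harm N" if "N \<ge> K" for N
  proof -
    have "E \<le> (\<Sum>k = 1..N. b k - c / real k)" unfolding E_def
      by (rule sum_mono2) (use that K in auto)
    also have "\<dots> = (\<Sum>k = 1..N. b k) - c * harm N"
      by (simp add: sum_subtractf harm_def sum_distrib_left divide_inverse)
    finally show ?thesis by simp
  qed
  have "eventually (\<lambda>N. harm N \<ge> (C + 1 - b 0 - 2 * E) / (2 * c)) sequentially"
    using harm_at_top unfolding filterlim_at_top by blast
  then obtain N1 where N1: "\<And>N. N \<ge> N1 \<Longrightarrow> harm N \<ge> (C + 1 - b 0 - 2 * E) / (2 * c)"
    unfolding eventually_sequentially by blast
  define N0 where "N0 = max N1 K"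
  have step: "toeplitz_sum b (Suc N) \<ge> toeplitz_sum b N + (C + 1)" if "N \<ge> N0" for N
  proof -
    have "C + 1 - b 0 - 2 * E \<le> 2 * c * harm N"
      using N1[of N] that c by (simp add: N0_def divide_le_eq mult_ac)
    then show ?thesis using low[of N] that unfolding toeplitz_sum_Suc by (simp add: N0_def)
  qed
  have grow: "toeplitz_sum b (N0 + j) \<ge> toeplitz_sum b N0 + (C + 1) * real j" for j
  proof (induction j)
    case (Suc j)
    then show ?case using step[of "N0 + j"] by (simp add: algebra_simps)
  qed simp
  obtain j where j: "real j > C * real N0 - toeplitz_sum b N0" using reals_Archimedean2 by blast
  have "toeplitz_sum b (N0 + j) \<le> C * real (N0 + j)" using bound[of "N0 + j"] by simp
  then show False using grow[of j] j by (simp add: algebra_simps)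
qed

text \<open>The Fejer kernel is a sum of squares. It represents the Cesaro means at x = 1 if s = 1 and at
x = -1 if s = -1.\<close>

lemma fejer_kernel:
  assumes "s \<in> {1, -1::real}"
  shows "(\<Sum>p<N. \<Sum>q<N. s ^ nat_dist p q * cos (real (nat_dist p q) * t)) =
    (\<Sum>p<N. s ^ p * cos (real p * t))\<^sup>2 + (\<Sum>p<N. s ^ p * sin (real p * t))\<^sup>2"
proof -
  have "s ^ nat_dist p q * cos (real (nat_dist p q) * t) =
    s ^ p * cos (real p * t) * (s ^ q * cos (real q * t)) + s ^ p * sin (real p * t) * (s ^ q * sin (real q * t))" for p q
  proof -
    have "s ^ nat_dist p q = s ^ p * s ^ q"
    proof (cases "p \<le> q")
      case True
      then obtain r where r: "q = p + r" using le_Suc_ex by blast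
      show ?thesis using assms unfolding r by (auto simp: nat_dist_def power_add)
    next
      case False
      then obtain r where r: "p = q + r" using le_Suc_ex nat_le_linear by blast
      show ?thesis using assms unfolding r by (auto simp: nat_dist_def power_add)
    qed
    moreover have "cos (real (nat_dist p q) * t) = cos (real p * t - real q * t)"
    proof (cases "p \<le> q")
      case True
      then have "real (nat_dist p q) * t = - (real p * t - real q * t)"
        by (simp add: nat_dist_def of_nat_diff algebra_simps)
      then show ?thesis by (simp only: cos_minus)
    next
      case False
      then have "real (nat_dist p q) * t = real p * t - real q * t"
        by (simp add: nat_dist_def of_nat_diff algebra_simps)
      then show ?thesis by (simp only:)
    qed
    ultimately show ?thesis by (simp add: cos_diff algebra_simps)
  qed
  then show ?thesis by (simp add: power2_eq_square sum_product sum.distrib)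
qed

text \<open>Integrating f(cos t) against a nonnegative kernel costs at most the maximum of |f| times the integral
of the kernel, which is N \<pi>.\<close>

lemma fejer_bound:
  assumes cont: "continuous_on {-1..1} f" and s: "s \<in> {1, -1::real}"
  obtains C where "\<And>N. \<bar>toeplitz_sum (\<lambda>k. s ^ k * cheb_coeff f k) N\<bar> \<le> C * real N"
proof -
  have cf: "continuous_on {0..pi} (\<lambda>t. f (cos t))" by (rule continuous_on_cos_arg[OF cont])
  have "bounded ((\<lambda>t. f (cos t)) ` {0..pi})"
    by (intro compact_imp_bounded compact_continuous_image cf) simp
  then obtain B where "\<forall>y\<in>(\<lambda>t. f (cos t)) ` {0..pi}. norm y \<le> B" unfolding bounded_iff by blast
  then have B: "\<And>t. t \<in> {0..pi} \<Longrightarrow> \<bar>f (cos t)\<bar> \<le> B" by auto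
  have "\<bar>toeplitz_sum (\<lambda>k. s ^ k * cheb_coeff f k) N\<bar> \<le> 2 * B * real N" for N
  proof -
    define K where "K = (\<lambda>t. \<Sum>p<N. \<Sum>q<N. s ^ nat_dist p q * cos (real (nat_dist p q) * t))"
    have K0: "K t \<ge> 0" for t unfolding K_def fejer_kernel[OF s] by simp
    have cK: "continuous_on {0..pi} K" unfolding K_def by (intro continuous_intros)
    have int: "(\<lambda>t. g t * cos (real k * t)) integrable_on {0..pi}" if "continuous_on {0..pi} g" for g k
      by (intro integrable_continuous_real continuous_intros that)
    have expand: "integral {0..pi} (\<lambda>t. g t * K t) = (\<Sum>p<N. \<Sum>q<N. s ^ nat_dist p q * integral {0..pi} (\<lambda>t. g t * cos (real (nat_dist p q) * t)))"
      if g: "continuous_on {0..pi} g" for g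
    proof -
      have "integral {0..pi} (\<lambda>t. g t * K t) = integral {0..pi} (\<lambda>t. \<Sum>p<N. \<Sum>q<N. s ^ nat_dist p q * (g t * cos (real (nat_dist p q) * t)))"
        by (simp add: K_def sum_distrib_left mult_ac)
      also have "\<dots> = (\<Sum>p<N. integral {0..pi} (\<lambda>t. \<Sum>q<N. s ^ nat_dist p q * (g t * cos (real (nat_dist p q) * t))))"
        by (intro integral_sum integrable_sum integrable_on_mult_right int g finite_lessThan)
      also have "\<dots> = (\<Sum>p<N. \<Sum>q<N. integral {0..pi} (\<lambda>t. s ^ nat_dist p q * (g t * cos (real (nat_dist p q) * t))))"
        by (intro sum.cong refl integral_sum integrable_on_mult_right int g finite_lessThan)
      finally show ?thesis by simp
    qed
    have eq: "toeplitz_sum (\<lambda>k. s ^ k * cheb_coeff f k) N = 2 / pi * integral {0..pi} (\<lambda>t. f (cos t) * K t)"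
      unfolding expand[OF cf] toeplitz_sum_def cheb_coeff_def by (simp add: sum_distrib_left mult_ac)
    have le: "\<bar>integral {0..pi} (\<lambda>t. f (cos t) * K t)\<bar> \<le> integral {0..pi} (\<lambda>t. B * K t)"
    proof -
      have "norm (integral {0..pi} (\<lambda>t. f (cos t) * K t)) \<le> integral {0..pi} (\<lambda>t. B * K t)"
      proof (rule integral_norm_bound_integral)
        fix t assume "t \<in> {0..pi}"
        then show "norm (f (cos t) * K t) \<le> B * K t"
          using B[of t] K0[of t] by (simp add: abs_mult mult_right_mono)
      qed (intro integrable_continuous_real continuous_intros cf cK)+
      then show ?thesis by simp
    qed
    have mass: "integral {0..pi} (\<lambda>t. B * K t) = B * (real N * pi)"
    proof -
      have one: "integral {0..pi} (\<lambda>t. 1 * cos (real k * t)) = (if k = 0 then pi else 0)" for k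
        using integral_unique[OF integral_cos_int[of "int k"]] by simp
      have "integral {0..pi} (\<lambda>t. 1 * K t) = (\<Sum>p<N. \<Sum>q<N. s ^ nat_dist p q * (if nat_dist p q = 0 then pi else 0))"
        unfolding expand[OF continuous_on_const] one ..
      also have "\<dots> = (\<Sum>p<N. \<Sum>q<N. if p = q then pi else 0)"
        by (intro sum.cong refl) (auto simp: nat_dist_def)
      also have "\<dots> = real N * pi" by simp
      finally show ?thesis by simp
    qed
    have "\<bar>toeplitz_sum (\<lambda>k. s ^ k * cheb_coeff f k) N\<bar> = 2 / pi * \<bar>integral {0..pi} (\<lambda>t. f (cos t) * K t)\<bar>"
      unfolding eq by (simp add: abs_mult)
    moreover have "\<bar>integral {0..pi} (\<lambda>t. f (cos t) * K t)\<bar> \<le> B * (real N * pi)"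
      using le mass by linarith
    ultimately have "\<bar>toeplitz_sum (\<lambda>k. s ^ k * cheb_coeff f k) N\<bar> \<le> 2 / pi * (B * (real N * pi))"
      by (simp only:) (intro mult_left_mono, auto)
    then show ?thesis by simp
  qed
  then show ?thesis using that by blast
qed

lemma toeplitz_sum_uminus: "toeplitz_sum (\<lambda>k. - b k) N = - toeplitz_sum b N"
  by (simp add: toeplitz_sum_def sum_negf)

text \<open>Take the first nonzero term with d_k \<le> 1. Up to sign it dominates c/n, so the Toeplitz sums
grow faster than linearly, contradicting \<open>fejer_bound\<close>.\<close>

lemma slow_terms_vanish:
  fixes f :: "real \<Rightarrow> real" and \<mu> d :: "nat \<Rightarrow> real"
  assumes cont: "continuous_on {-1..1} f" and s: "s \<in> {1, -1::real}" and d: "strict_mono d"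
    and exp: "poincare_expansion sequentially (\<lambda>n. s ^ n * cheb_coeff f n) d (\<lambda>k n. \<mu> k / real n powr d k)"
  shows "d k \<le> 1 \<Longrightarrow> \<mu> k = 0"
proof (induction k rule: less_induct)
  case (less k)
  show ?case
  proof (rule ccontr)
    assume mu: "\<mu> k \<noteq> 0"
    define b where "b = (\<lambda>n. s ^ n * cheb_coeff f n)"
    have set: "{i. d i \<le> d k} = {..k}" using d by (auto simp: strict_mono_less_eq)
    have "(\<Sum>i | d i \<le> d k. \<mu> i / real n powr d i) = \<mu> k / real n powr d k" for n
    proof -
      have "(\<Sum>i\<le>k. \<mu> i / real n powr d i) = (\<Sum>i\<in>{k}. \<mu> i / real n powr d i)"
      proof (rule sum.mono_neutral_right)
        show "\<forall>i\<in>{..k} - {k}. \<mu> i / real n powr d i = 0"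
        proof
          fix i assume i: "i \<in> {..k} - {k}"
          then have "d i < d k" using d by (auto simp: strict_mono_less)
          then show "\<mu> i / real n powr d i = 0" using less.IH[of i] i less.prems by auto
        qed
      qed auto
      then show ?thesis unfolding set by simp
    qed
    moreover have "(\<lambda>n. b n - (\<Sum>i | d i \<le> d k. \<mu> i / real n powr d i)) \<in> o(\<lambda>n. real n powr - d k)"
      using exp unfolding poincare_expansion_def b_def by blast
    ultimately have "(\<lambda>n. b n - \<mu> k / real n powr d k) \<in> o(\<lambda>n. real n powr - d k)"
      by (simp only:)
    then have "eventually (\<lambda>n. \<bar>b n - \<mu> k / real n powr d k\<bar> \<le> \<bar>\<mu> k\<bar> / 2 * \<bar>real n powr - d k\<bar>) sequentially"
      using mu landau_o.smallD[of "\<lambda>n. b n - \<mu> k / real n powr d k" sequentially "\<lambda>n. real n powr - d k" "\<bar>\<mu> k\<bar> / 2"] by simp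
    then have ev: "eventually (\<lambda>n. sgn (\<mu> k) * b n \<ge> \<bar>\<mu> k\<bar> / 2 / real n) sequentially"
      using eventually_ge_at_top[of 1]
    proof eventually_elim
      case (elim n)
      define w where "w = real n powr - d k"
      have n: "real n \<ge> 1" using elim(2) by simp
      have "real n powr - 1 \<le> real n powr - d k" by (rule powr_mono) (use less.prems n in simp_all)
      moreover have "real n powr - 1 = 1 / real n" using n by (simp add: powr_minus_divide)
      ultimately have w: "1 / real n \<le> w" "w \<ge> 0" by (simp_all add: w_def)
      have muw: "\<mu> k / real n powr d k = \<mu> k * w" by (simp add: w_def powr_minus divide_inverse)
      have "\<bar>b n - \<mu> k * w\<bar> \<le> \<bar>\<mu> k\<bar> / 2 * w" using elim(1) w(2) unfolding muw w_def[symmetric] by simp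
      moreover have "\<bar>sgn (\<mu> k) * (b n - \<mu> k * w)\<bar> = \<bar>b n - \<mu> k * w\<bar>" using mu by (simp add: abs_mult)
      moreover have "sgn (\<mu> k) * (b n - \<mu> k * w) = sgn (\<mu> k) * b n - \<bar>\<mu> k\<bar> * w"
        by (simp add: right_diff_distrib abs_sgn mult_ac)
      ultimately have "sgn (\<mu> k) * b n \<ge> \<bar>\<mu> k\<bar> / 2 * w" by linarith
      moreover have "\<bar>\<mu> k\<bar> / 2 * (1 / real n) \<le> \<bar>\<mu> k\<bar> / 2 * w" using w by (intro mult_left_mono) auto
      ultimately show ?case by simp
    qed
    obtain C where C: "\<And>N. \<bar>toeplitz_sum b N\<bar> \<le> C * real N" unfolding b_def using fejer_bound[OF cont s] by blast
    have "\<bar>toeplitz_sum (\<lambda>n. sgn (\<mu> k) * b n) N\<bar> \<le> C * real N" for N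
      using C[of N] mu by (cases "\<mu> k > 0") (simp_all add: toeplitz_sum_uminus)
    from toeplitz_sum_unbounded[OF _ ev this] mu show False by simp
  qed
qed

section \<open>The expansion of the quadrature error\<close>

lemma even_sequentially_le: "even_sequentially \<le> sequentially"
  by (simp add: even_sequentially_def)

lemma powr_smallo_even:
  assumes "p < q" shows "(\<lambda>n. c / real n powr q) \<in> o[even_sequentially](\<lambda>n. real n powr - p)"
proof -
  have "(\<lambda>n. real n powr - q) \<in> o(\<lambda>n. real n powr - p)"
    using assms by (subst powr_smallo_iff) (auto intro: filterlim_real_sequentially)
  then have "(\<lambda>n. c * real n powr - q) \<in> o(\<lambda>n. real n powr - p)" by simp
  then have "(\<lambda>n. c / real n powr q) \<in> o(\<lambda>n. real n powr - p)" by (simp add: powr_minus_divide)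
  then show ?thesis by (rule landau_o.small.filter_mono[OF even_sequentially_le])
qed

text \<open>Only degrees m \<ge> n enter the error of the (n+1)-point rule, so the smallness of the coefficients at infinity
is inherited with the same rate.\<close>

lemma fold_term_smallo:
  assumes M: "M > 1"
    and R: "(\<lambda>n. R (real n)) \<in> o[even_sequentially](\<lambda>n. real n powr - M)"
  shows "eventually (\<lambda>n. summable (fold_term n R)) even_sequentially"
    and "(\<lambda>n. \<Sum>l. fold_term n R l) \<in> o[even_sequentially](\<lambda>n. real n powr - M)"
proof -
  define C where "C = 8 * (\<Sum>l. real (Suc l) powr - M)"
  have C: "C \<ge> 0" unfolding C_def by (intro mult_nonneg_nonneg suminf_nonneg summable_Suc_powr M) auto
  have ev: "eventually (\<lambda>n. summable (fold_term n R) \<and> \<bar>\<Sum>l. fold_term n R l\<bar> \<le> C * e * real n powr - M) even_sequentially"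
    if e: "e > 0" for e
  proof -
    have "eventually (\<lambda>n. even n \<longrightarrow> \<bar>R (real n)\<bar> \<le> e * real n powr - M) sequentially"
      using landau_o.smallD[OF R e] unfolding eventually_even_sequentially by simp
    then obtain N where N: "\<And>n. n \<ge> N \<Longrightarrow> even n \<Longrightarrow> \<bar>R (real n)\<bar> \<le> e * real n powr - M"
      unfolding eventually_sequentially by blast
    show ?thesis
    proof (rule eventually_mono[OF even_sequentially_ge[of "max N 2"]])
      fix n :: nat assume n: "even n \<and> max N 2 \<le> n"
      then have n': "even n" "n \<ge> 2" "n \<ge> N" by auto
      have b: "\<bar>R (real m)\<bar> \<le> e * real m powr - M" if "even m" "m \<ge> n" for m
        using N[of m] that n' by simp
      from fold_term_bound[OF M n'(1,2) less_imp_le[OF e] b]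
      show "summable (fold_term n R) \<and> \<bar>\<Sum>l. fold_term n R l\<bar> \<le> C * e * real n powr - M"
        unfolding C_def by blast
    qed
  qed
  show "eventually (\<lambda>n. summable (fold_term n R)) even_sequentially"
    using ev[of 1] by (auto elim: eventually_mono)
  show "(\<lambda>n. \<Sum>l. fold_term n R l) \<in> o[even_sequentially](\<lambda>n. real n powr - M)"
  proof (rule landau_o.smallI)
    fix c :: real assume c: "c > 0"
    \<comment> \<open>C + 1 avoids division by zero.\<close>
    have "C * (c / (C + 1)) \<le> c" using C c by (simp add: field_simps)
    then have *: "C * (c / (C + 1)) * real n powr - M \<le> c * real n powr - M" for n
      by (rule mult_right_mono) simp
    have "c / (C + 1) > 0" using C c by simp
    from ev[OF this] show "eventually (\<lambda>n. norm (\<Sum>l. fold_term n R l) \<le> c * norm (real n powr - M)) even_sequentially"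
    proof (rule eventually_mono)
      fix n :: nat assume h: "summable (fold_term n R) \<and> \<bar>\<Sum>l. fold_term n R l\<bar> \<le> C * (c / (C + 1)) * real n powr - M"
      then show "norm (\<Sum>l. fold_term n R l) \<le> c * norm (real n powr - M)"
        using order_trans[OF conjunct2[OF h] *[of n]] by simp
    qed
  qed
qed

lemma trapezoid_sum: "trapezoid n (\<lambda>k. \<Sum>i\<in>I. g i k) = (\<Sum>i\<in>I. trapezoid n (g i))"
  unfolding trapezoid_def 
  by (subst sum.swap, intro sum.cong refl) (simp only: sum.distrib sum_divide_distrib[symmetric])

text \<open>Summability is asked only of terms with nonzero coefficient, since for a power law x^(-d) it is
at hand only if d > 1.\<close>

lemma fold_term_sums_lincomb:
  assumes A: "\<And>x. A x = (\<Sum>i\<in>I. c i * B i x) + R x"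
    and B: "\<And>i. i \<in> I \<Longrightarrow> c i \<noteq> 0 \<Longrightarrow> summable (fold_term n (B i))" and R: "summable (fold_term n R)"
  shows "fold_term n A sums ((\<Sum>i\<in>I. c i * (\<Sum>l. fold_term n (B i) l)) + (\<Sum>l. fold_term n R l))"
proof -
  have "fold_term n A = (\<lambda>l. (\<Sum>i\<in>I. c i * fold_term n (B i) l) + fold_term n R l)"
  proof
    fix l
    define w where "w = (\<lambda>k. 2 / (1 - (alias_degree n l k)\<^sup>2) - 2 / (1 - k\<^sup>2))"
    have "fold_term n A l = trapezoid n (\<lambda>k. 1 * (\<Sum>i\<in>I. c i * (B i (alias_degree n l k) * w k)) + 1 * (R (alias_degree n l k) * w k))"
      unfolding fold_term_def w_def by (intro trapezoid_cong) (simp only: A distrib_right sum_distrib_right mult.assoc mult_1_left)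
    also have "\<dots> = (\<Sum>i\<in>I. c i * fold_term n (B i) l) + fold_term n R l"
      unfolding trapezoid_lincomb trapezoid_sum trapezoid_cmult by (simp add: fold_term_def w_def)
    finally show "fold_term n A l = (\<Sum>i\<in>I. c i * fold_term n (B i) l) + fold_term n R l" .
  qed
  moreover have "(\<lambda>l. (\<Sum>i\<in>I. c i * fold_term n (B i) l) + fold_term n R l) sums
    ((\<Sum>i\<in>I. c i * (\<Sum>l. fold_term n (B i) l)) + (\<Sum>l. fold_term n R l))"
  proof (intro sums_add sums_sum)
    fix i assume i: "i \<in> I"
    show "(\<lambda>l. c i * fold_term n (B i) l) sums (c i * (\<Sum>l. fold_term n (B i) l))"
      using B[OF i] by (cases "c i = 0") (auto intro: sums_mult summable_sums)
  qed (use R in \<open>auto intro: summable_sums\<close>)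
  ultimately show ?thesis by (simp only:)
qed

lemma summable_fold_term_powr:
  assumes "d > 1" "even n" "n \<ge> 2" shows "summable (fold_term n (\<lambda>x. x powr - d))"
  by (rule fold_term_bound(1)[of d n 1]) (use assms in auto)

lemma cheb_coeff_abs_summable:
  fixes f :: "real \<Rightarrow> real" and \<mu> d :: "nat \<Rightarrow> real"
  assumes exp: "poincare_expansion sequentially (\<lambda>n. s ^ n * cheb_coeff f n) d (\<lambda>k n. \<mu> k / real n powr d k)"
    and s: "s \<in> {1, -1::real}" and van: "\<And>k. d k \<le> 1 \<Longrightarrow> \<mu> k = 0"
  shows "summable (\<lambda>m. \<bar>cheb_coeff f m\<bar>)"
proof -
  define I where "I = {k. d k \<le> 2}"
  define r where "r = (\<lambda>n. s ^ n * cheb_coeff f n - (\<Sum>k\<in>I. \<mu> k / real n powr d k))"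
  have "r \<in> o(\<lambda>n. real n powr - 2)"
    using exp unfolding poincare_expansion_def I_def r_def by blast
  from landau_o.smallD[OF this, of 1]
  have ev: "eventually (\<lambda>n. norm (s ^ n * cheb_coeff f n) \<le> real n powr - 2 + (\<Sum>k\<in>I. \<bar>\<mu> k\<bar> * real n powr - d k)) sequentially"
  proof (simp, elim eventually_mono)
    fix n :: nat assume r: "\<bar>r n\<bar> \<le> real n powr - 2"
    have "\<bar>s ^ n * cheb_coeff f n\<bar> \<le> \<bar>r n\<bar> + \<bar>\<Sum>k\<in>I. \<mu> k / real n powr d k\<bar>"
      using abs_triangle_ineq[of "r n" "\<Sum>k\<in>I. \<mu> k / real n powr d k"] by (simp add: r_def)
    also have "\<bar>\<Sum>k\<in>I. \<mu> k / real n powr d k\<bar> \<le> (\<Sum>k\<in>I. \<bar>\<mu> k / real n powr d k\<bar>)" by (rule sum_abs)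
    also have "\<dots> = (\<Sum>k\<in>I. \<bar>\<mu> k\<bar> * real n powr - d k)" by (simp add: powr_minus_divide abs_divide)
    finally show "\<bar>s ^ n * cheb_coeff f n\<bar> \<le> real n powr - 2 + (\<Sum>k\<in>I. \<bar>\<mu> k\<bar> * real n powr - d k)" using r by simp
  qed
  have "summable (\<lambda>n. real n powr - 2 + (\<Sum>k\<in>I. \<bar>\<mu> k\<bar> * real n powr - d k))"
  proof (intro summable_add summable_sum)
    fix k
    show "summable (\<lambda>n. \<bar>\<mu> k\<bar> * real n powr - d k)"
    proof (cases "\<mu> k = 0")
      case False
      then have "d k > 1" using van[of k] by (meson not_le)
      then show ?thesis by (intro summable_mult) (simp add: summable_real_powr_iff)
    qed simp
  qed (simp add: summable_real_powr_iff)
  then have "summable (\<lambda>n. \<bar>s ^ n * cheb_coeff f n\<bar>)"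
    by (rule summable_comparison_test_ev[rotated]) (use ev in simp)
  moreover have "\<bar>s ^ n * cheb_coeff f n\<bar> = \<bar>cheb_coeff f n\<bar>" for n
    using s by (auto simp: abs_mult power_abs)
  ultimately show ?thesis by simp
qed

text \<open>Both cases of the theorem at once, the sign being s = 1 or s = -1. Since only even degrees matter,
s^n disappears in the passage to the remainder R.\<close>

lemma cc_error_expansion:
  fixes f :: "real \<Rightarrow> real" and \<mu> d :: "nat \<Rightarrow> real"
  assumes cont: "continuous_on {-1..1} f" and d0: "0 < d 0" and mono: "strict_mono d"
    and s: "s \<in> {1, -1::real}"
    and exp: "poincare_expansion sequentially (\<lambda>n. s ^ n * cheb_coeff f n) d (\<lambda>k n. \<mu> k / real n powr d k)"
  shows "\<exists>\<sigma> :: nat \<Rightarrow> nat \<Rightarrow> real.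
           poincare_expansion even_sequentially (\<lambda>n. cc_error n f)
             (\<lambda>(j, k). d k + 2 * real j + 1)
             (\<lambda>(j, k) n. \<sigma> j k / real n powr (d k + 2 * real j + 1))"
proof -
  have van: "\<mu> k = 0" if "d k \<le> 1" for k
    by (rule slow_terms_vanish[OF cont s mono exp that])
  have summ: "summable (\<lambda>m. \<bar>cheb_coeff f m\<bar>)" by (rule cheb_coeff_abs_summable[OF exp s van])
  have dpos: "d k > 0" for k
    using d0 mono strict_mono_less_eq[of d 0 k] by simp
  define Q where "Q = (\<lambda>k n. \<Sum>l. fold_term n (\<lambda>x. x powr - d k) l)"
  have "\<forall>k. \<exists>e :: nat \<Rightarrow> real. d k > 1 \<longrightarrow> (\<forall>J. (\<lambda>n. real n powr (d k + 1) * Q k n - (\<Sum>j<J. e j / real n ^ (2 * j))) \<in> O[even_sequentially](\<lambda>n. 1 / real n ^ (2 * J)))"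
    using fold_term_powr_expansion unfolding even_expansion_def Q_def by blast
  from choice[OF this] obtain e :: "nat \<Rightarrow> nat \<Rightarrow> real" where e: "\<And>k J. d k > 1 \<Longrightarrow>
    (\<lambda>n. real n powr (d k + 1) * Q k n - (\<Sum>j<J. e k j / real n ^ (2 * j))) \<in> O[even_sequentially](\<lambda>n. 1 / real n ^ (2 * J))"
    by blast
  define \<sigma> where "\<sigma> = (\<lambda>j k. \<mu> k * e k j)"
  define T where "T = (\<lambda>(j, k) n. \<sigma> j k / real n powr (d k + 2 * real j + 1))"
  show ?thesis
  proof (rule exI[of _ \<sigma>], unfold poincare_expansion_def T_def[symmetric], intro allI)
    fix M' :: real
    \<comment> \<open>The remainder must be summable, so at least the precision n^(-2) is kept.\<close>
    define M where "M = max M' 2"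
    have M: "M > 1" "M \<ge> M'" by (simp_all add: M_def)
    \<comment> \<open>Large enough that terms with j \<ge> J have exponent above M'.\<close>
    define J where "J = Suc (nat \<lceil>M'\<rceil>)"
    have J: "2 * real J > M'" unfolding J_def using real_nat_ceiling_ge[of M'] by simp
    define K where "K = {k. d k \<le> M}"
    have finK: "finite K" using exp unfolding poincare_expansion_def K_def by blast
    define P where "P = {p. (case p of (j, k) \<Rightarrow> d k + 2 * real j + 1) \<le> M'}"
    have PK: "P \<subseteq> {..<J} \<times> K"
    proof
      fix p assume "p \<in> P"
      then obtain j k where p: "p = (j, k)" "d k + 2 * real j + 1 \<le> M'"
        by (cases p) (auto simp: P_def)
      have "2 * real j < 2 * real J" using p(2) J dpos[of k] by linarith
      moreover have "d k \<le> M" using p(2) M(2) by linarith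
      ultimately show "p \<in> {..<J} \<times> K" by (simp add: p(1) K_def)
    qed
    have finP: "finite P" by (rule finite_subset[OF PK]) (simp add: finK)
    define A :: "real \<Rightarrow> real" where "A = (\<lambda>x. cheb_coeff f (nat \<lfloor>x\<rfloor>))"
    define R where "R = (\<lambda>x. A x - (\<Sum>k\<in>K. \<mu> k * x powr - d k))"
    have R: "(\<lambda>n. R (real n)) \<in> o[even_sequentially](\<lambda>n. real n powr - M)"
    proof -
      have "(\<lambda>n. s ^ n * cheb_coeff f n - (\<Sum>k\<in>K. \<mu> k / real n powr d k)) \<in> o(\<lambda>n. real n powr - M)"
        using exp unfolding poincare_expansion_def K_def by blast
      then have "(\<lambda>n. s ^ n * cheb_coeff f n - (\<Sum>k\<in>K. \<mu> k / real n powr d k)) \<in> o[even_sequentially](\<lambda>n. real n powr - M)"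
        by (rule landau_o.small.filter_mono[OF even_sequentially_le])
      also have "?this \<longleftrightarrow> ?thesis"
        using even_sequentially_ge[of 0] s
        by (intro landau_o.small.in_cong) (auto elim!: eventually_mono simp: R_def A_def powr_minus_divide)
      finally show ?thesis .
    qed
    have err: "eventually (\<lambda>n. cc_error n f = (\<Sum>k\<in>K. \<mu> k * Q k n) + (\<Sum>l. fold_term n R l)) even_sequentially"
      using fold_term_smallo(1)[OF M(1) R] even_sequentially_ge[of 2]
    proof eventually_elim
      case (elim n)
      have "fold_term n A sums ((\<Sum>k\<in>K. \<mu> k * (\<Sum>l. fold_term n (\<lambda>x. x powr - d k) l)) + (\<Sum>l. fold_term n R l))"
      proof (rule fold_term_sums_lincomb[where R = R])
        fix k assume "\<mu> k \<noteq> 0"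
        then have "d k > 1" using van[of k] by (meson not_le)
        then show "summable (fold_term n (\<lambda>x. x powr - d k))"
          using elim by (intro summable_fold_term_powr) auto
      qed (use elim in \<open>simp_all add: R_def\<close>)
      moreover have "fold_term n A sums cc_error n f"
        unfolding A_def using elim by (intro fold_term_sums_cc_error cont summ) auto
      ultimately show ?case unfolding Q_def by (rule sums_unique2[rotated])
    qed
    have Qexp: "(\<lambda>n. \<mu> k * Q k n - (\<Sum>j<J. T (j, k) n)) \<in> o[even_sequentially](\<lambda>n. real n powr - M')" for k
    proof (cases "\<mu> k = 0")
      case True
      then show ?thesis by (simp add: T_def \<sigma>_def)
    next
      case False
      then have dk: "d k > 1" using van[of k] by (meson not_le)
      have "(\<lambda>n. \<mu> k * real n powr - (d k + 1) * (real n powr (d k + 1) * Q k n - (\<Sum>j<J. e k j / real n ^ (2 * j))))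
        \<in> O[even_sequentially](\<lambda>n. \<mu> k * real n powr - (d k + 1) * (1 / real n ^ (2 * J)))"
        by (intro landau_o.big.mult_left e dk)
      also have "(\<lambda>n. \<mu> k * real n powr - (d k + 1) * (1 / real n ^ (2 * J))) \<in> o[even_sequentially](\<lambda>n. real n powr - M')"
      proof -
        have "(\<lambda>n. \<mu> k / real n powr (d k + 1 + 2 * real J)) \<in> o[even_sequentially](\<lambda>n. real n powr - M')"
          by (rule powr_smallo_even) (use J dk in linarith)
        also have "?this \<longleftrightarrow> ?thesis"
        proof (intro landau_o.small.in_cong eventually_mono[OF even_sequentially_ge[of 1]])
          fix n :: nat assume "even n \<and> 1 \<le> n"
          then have p: "real n powr (2 * real J) = real n ^ (2 * J)" using powr_realpow[of "real n" "2 * J"] by simp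
          have split: "real n powr (d k + 1 + 2 * real J) = real n powr (d k + 1) * real n powr (2 * real J)"
            by (rule powr_add)
          show "\<mu> k / real n powr (d k + 1 + 2 * real J) = \<mu> k * real n powr - (d k + 1) * (1 / real n ^ (2 * J))"
            unfolding split p powr_minus_divide[of _ "d k + 1"] by simp
        qed
        finally show ?thesis .
      qed
      finally have "(\<lambda>n. \<mu> k * real n powr - (d k + 1) * (real n powr (d k + 1) * Q k n - (\<Sum>j<J. e k j / real n ^ (2 * j))))
        \<in> o[even_sequentially](\<lambda>n. real n powr - M')" .
      also have "?this \<longleftrightarrow> ?thesis"
      proof (intro landau_o.small.in_cong eventually_mono[OF even_sequentially_ge[of 1]])
        fix n :: nat assume n: "even n \<and> 1 \<le> n"
        define w where "w = real n powr (d k + 1)"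
        have w: "w \<noteq> 0" "real n powr - (d k + 1) = 1 / w" using n unfolding w_def powr_minus_divide[of _ "d k + 1"] by simp_all
        have "T (j, k) n = \<mu> k * (1 / w) * (e k j / real n ^ (2 * j))" for j
        proof -
          have "real n powr (2 * real j) = real n ^ (2 * j)" using n powr_realpow[of "real n" "2 * j"] by simp
          moreover have "real n powr (d k + 2 * real j + 1) = w * real n powr (2 * real j)"
            unfolding w_def powr_add[symmetric] by (simp add: add_ac)
          ultimately show ?thesis by (simp add: T_def \<sigma>_def)
        qed
        then have "(\<Sum>j<J. T (j, k) n) = \<mu> k * (1 / w) * (\<Sum>j<J. e k j / real n ^ (2 * j))"
          by (simp add: sum_distrib_left)
        then show "\<mu> k * real n powr - (d k + 1) * (real n powr (d k + 1) * Q k n - (\<Sum>j<J. e k j / real n ^ (2 * j))) =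
          \<mu> k * Q k n - (\<Sum>j<J. T (j, k) n)"
          unfolding w(2) w_def[symmetric] using w(1) by (simp add: right_diff_distrib)
      qed
      finally show ?thesis .
    qed
    have "(\<lambda>n. (\<Sum>k\<in>K. \<mu> k * Q k n - (\<Sum>j<J. T (j, k) n)) + (\<Sum>p\<in>{..<J} \<times> K - P. T p n) + (\<Sum>l. fold_term n R l))
      \<in> o[even_sequentially](\<lambda>n. real n powr - M')"
    proof (intro sum_in_smallo(1) big_sum_in_smallo Qexp)
      fix p assume "p \<in> {..<J} \<times> K - P"
      then obtain j k where p: "p = (j, k)" "d k + 2 * real j + 1 > M'" by (cases p) (auto simp: P_def)
      show "T p \<in> o[even_sequentially](\<lambda>n. real n powr - M')"
        unfolding p T_def prod.case by (rule powr_smallo_even[OF p(2)])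
    next
      have "(\<lambda>n. real n powr - M) \<in> O(\<lambda>n. real n powr - M')"
        using M(2) by (subst powr_bigo_iff) (auto intro: filterlim_real_sequentially)
      then have "(\<lambda>n. real n powr - M) \<in> O[even_sequentially](\<lambda>n. real n powr - M')"
        by (rule landau_o.big.filter_mono[OF even_sequentially_le])
      with fold_term_smallo(2)[OF M(1) R]
      show "(\<lambda>n. \<Sum>l. fold_term n R l) \<in> o[even_sequentially](\<lambda>n. real n powr - M')"
        by (rule landau_o.small_big_trans)
    qed
    also have "?this \<longleftrightarrow> (\<lambda>n. cc_error n f - (\<Sum>p\<in>P. T p n)) \<in> o[even_sequentially](\<lambda>n. real n powr - M')"
    proof (intro landau_o.small.in_cong eventually_mono[OF err])
      fix n :: nat assume n: "cc_error n f = (\<Sum>k\<in>K. \<mu> k * Q k n) + (\<Sum>l. fold_term n R l)"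
      have "(\<Sum>p\<in>{..<J} \<times> K. T p n) = (\<Sum>j<J. \<Sum>k\<in>K. T (j, k) n)"
        by (simp add: sum.cartesian_product)
      then have 1: "(\<Sum>k\<in>K. \<Sum>j<J. T (j, k) n) = (\<Sum>p\<in>{..<J} \<times> K. T p n)"
        by (simp add: sum.swap[of _ K])
      have 2: "(\<Sum>p\<in>{..<J} \<times> K - P. T p n) = (\<Sum>p\<in>{..<J} \<times> K. T p n) - (\<Sum>p\<in>P. T p n)"
        by (rule sum_diff[OF _ PK]) (simp add: finK)
      show "(\<Sum>k\<in>K. \<mu> k * Q k n - (\<Sum>j<J. T (j, k) n)) + (\<Sum>p\<in>{..<J} \<times> K - P. T p n) + (\<Sum>l. fold_term n R l) =
        cc_error n f - (\<Sum>p\<in>P. T p n)"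
        unfolding n sum_subtractf 1 2 by simp
    qed
    finally have "(\<lambda>n. cc_error n f - (\<Sum>p\<in>P. T p n)) \<in> o[even_sequentially](\<lambda>n. real n powr - M')" .
    then show "finite {i. (case i of (j, k) \<Rightarrow> d k + 2 * real j + 1) \<le> M'} \<and>
      (\<lambda>n. cc_error n f - (\<Sum>i | (case i of (j, k) \<Rightarrow> d k + 2 * real j + 1) \<le> M'. T i n)) \<in> o[even_sequentially](\<lambda>n. real n powr - M')"
      using finP unfolding P_def by blast
  qed
qed

theorem theorem4p1:
  fixes f :: "real \<Rightarrow> real" and \<mu> d :: "nat \<Rightarrow> real"
  assumes "continuous_on {-1..1} f"
    and "0 < d 0" and "strict_mono d"
    and "poincare_expansion sequentially (cheb_coeff f) d
           (\<lambda>k n. \<mu> k / real n powr d k)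
       \<or> poincare_expansion sequentially (cheb_coeff f) d
           (\<lambda>k n. (-1) ^ n * (\<mu> k / real n powr d k))"
  shows "\<exists>\<sigma> :: nat \<Rightarrow> nat \<Rightarrow> real.
           poincare_expansion even_sequentially (\<lambda>n. cc_error n f)
             (\<lambda>(j, k). d k + 2 * real j + 1)
             (\<lambda>(j, k) n. \<sigma> j k / real n powr (d k + 2 * real j + 1))"
  using assms(4)
proof
  assume "poincare_expansion sequentially (cheb_coeff f) d (\<lambda>k n. \<mu> k / real n powr d k)"
  then show ?thesis
    by (intro cc_error_expansion[OF assms(1-3), where s = 1]) simp_all
next
  assume exp: "poincare_expansion sequentially (cheb_coeff f) d (\<lambda>k n. (-1) ^ n * (\<mu> k / real n powr d k))"
  have "(\<lambda>n. (-1) ^ n * cheb_coeff f n - (\<Sum>k | d k \<le> M. \<mu> k / real n powr d k)) \<in> o(\<lambda>n. real n powr - M)" for M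
  proof -
    have "(\<lambda>n. (-1) ^ n * (cheb_coeff f n - (\<Sum>k | d k \<le> M. (-1) ^ n * (\<mu> k / real n powr d k)))) \<in> o(\<lambda>n. (-1) ^ n * real n powr - M)"
      using exp unfolding poincare_expansion_def by (intro landau_o.small.mult_left) blast
    moreover have "(-1) ^ n * (cheb_coeff f n - (\<Sum>k | d k \<le> M. (-1) ^ n * (\<mu> k / real n powr d k))) =
      (-1) ^ n * cheb_coeff f n - (\<Sum>k | d k \<le> M. \<mu> k / real n powr d k)" for n
    proof -
      have "(-1) ^ n * ((-1) ^ n * z) = z" for z :: real by (cases "even n") auto
      then show ?thesis unfolding right_diff_distrib sum_distrib_left by simp
    qed
    moreover have "(\<lambda>n. (-1) ^ n * real n powr - M) \<in> O(\<lambda>n. real n powr - M)"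
      by (rule bigoI[of _ 1]) (simp add: abs_mult power_abs)
    ultimately show ?thesis by (simp only: landau_o.small_big_trans)
  qed
  then have "poincare_expansion sequentially (\<lambda>n. (-1) ^ n * cheb_coeff f n) d (\<lambda>k n. \<mu> k / real n powr d k)"
    using exp unfolding poincare_expansion_def by blast
  then show ?thesis
    by (intro cc_error_expansion[OF assms(1-3), where s = "-1"]) simp_all
qed

end
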